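(* Let $(A;d,\cdot,l_3)$ be an associative 2-algebra and let $V=(V_1\xrightarrow{d_V}V_0)$ be a representation of $A$. There is a one-to-one correspondence between equivalence classes of abelian extensions of $A$ by $V$ (inducing the given representation of $A$ on $V$) and the second cohomology group $\mathbf H^2(A;V)$.
   Context: All vector spaces are over a fixed field. An associative 2-algebra $A=A_1\oplus A_0$, written $(A;d,\cdot,l_3)$, consists of a linear map $d:A_1\to A_0$, bilinear products $A_i\otimes A_j\to A_{i+j}$ for $0\le i+j\le 1$ (all written $\cdot$), and a trilinear map $l_3:A_0\otimes A_0\otimes A_0\to A_1$ such that for all $x,y,z,t\in A_0$, $a,b\in A_1$: (a) $d(x\cdot a)=x\cdot da$; (b) $d(a\cdot x)=da\cdot x$; (c) $da\cdot b=a\cdot db$; (d) $d\,l_3(x,y,z)=(x\cdot y)\cdot z-x\cdot(y\cdot z)$; (e1) $l_3(x,y,da)=(x\cdot y)\cdot a-x\cdot(y\cdot a)$; (e2) $l_3(x,da,y)=(x\cdot a)\cdot y-x\cdot(a\cdot y)$; (e3) $l_3(da,x,y)=(a\cdot x)\cdot y-a\cdot(x\cdot y)$; (f) $x\cdot l_3(y,z,t)+l_3(x,y,z)\cdot t=l_3(x\cdot y,z,t)-l_3(x,y\cdot z,t)+l_3(x,y,z\cdot t)$. A homomorphism $F:(A;d,\cdot,l_3)\to(A';d',\cdot',l_3')$ consists of linear maps $F_0:A_0\to A_0'$, $F_1:A_1\to A_1'$ and a bilinear map $F_2:A_0\times A_0\to A_1'$ with $F_0d=d'F_1$; $F_0(x\cdot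 y)-F_0(x)\cdot'F_0(y)=d'F_2(x,y)$; $F_1(x\cdot a)-F_0(x)\cdot'F_1(a)=F_2(x,da)$; $F_1(a\cdot x)-F_1(a)\cdot'F_0(x)=F_2(da,x)$; $F_1(l_3(x,y,z))-l_3'(F_0x,F_0y,F_0z)=F_2(x,y\cdot z)-F_2(x\cdot y,z)+F_0(x)\cdot'F_2(y,z)-F_2(x,y)\cdot'F_0(z)$. It is strict if $F_2=0$. Composition is $(GF)_0=G_0F_0$, $(GF)_1=G_1F_1$, $(GF)_2=G_2\circ(F_0\times F_0)+G_1\circ F_2$. A representation of $A$ on a 2-term complex $d_V:V_1\to V_0$ consists of an action of $A_0$ on $V$ (bilinear maps $\triangleright:A_0\otimes V_i\to V_i$, $\triangleleft:V_i\otimes A_0\to V_i$, $i=0,1$), bilinear maps $\triangleright:A_1\otimes V_0\to V_1$, $\triangleleft:V_0\otimes A_1\to V_1$, and three trilinear maps with values in $V_1$, written $(x,y,u)\mapsto[x,y,u]$, $(x,u,y)\mapsto[x,u,y]$, $(u,x,y)\mapsto[u,x,y]$ ($x,y\in A_0$, $u\in V_0$), such that for all $x,y,z\in A_0$, $a\in A_1$, $u\in V_0$, $m\in V_1$: - $(x\cdot y)\triangleright u-x\triangleright(y\triangleright u)=d_V[x,y,u]$, $(x\cdot y)\triangleright m-x\triangleright(y\triangleright m)=[x,y,d_Vm]$, $(x\cdot a)\triangleright u-x\triangleright(a\triangleright u)=[x,da,u]$, $(a\cdot x)\triangleright u-a\triangleright(x\triangleright u)=[da,x,u]$; - $(x\triangleright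 u)\triangleleft y-x\triangleright(u\triangleleft y)=d_V[x,u,y]$, $(x\triangleright m)\triangleleft y-x\triangleright(m\triangleleft y)=[x,d_Vm,y]$, $(x\triangleright u)\triangleleft a-x\triangleright(u\triangleleft a)=[x,u,da]$, $(a\triangleright u)\triangleleft y-a\triangleright(u\triangleleft y)=[da,u,y]$; - $u\triangleleft(x\cdot y)-(u\triangleleft x)\triangleleft y=d_V[u,x,y]$, $m\triangleleft(x\cdot y)-(m\triangleleft x)\triangleleft y=[d_Vm,x,y]$, $u\triangleleft(x\cdot a)-(u\triangleleft x)\triangleleft a=[u,x,da]$, $u\triangleleft(a\cdot x)-(u\triangleleft a)\triangleleft x=[u,da,x]$; - $x\triangleright[u,y,z]+[x,u,y]\triangleleft z=[x\triangleright u,y,z]-[x,u\triangleleft y,z]+[x,u,y\cdot z]$; - $x\triangleright[y,u,z]+[x,y,u]\triangleleft z=[x\cdot y,u,z]-[x,y\triangleright u,z]+[x,y,u\triangleleft z]$; - $x\triangleright[y,z,u]+l_3(x,y,z)\triangleright u=[x\cdot y,z,u]-[x,y\cdot z,u]+[x,y,z\triangleright u]$; - $u\triangleleft l_3(x,y,z)+[u,x,y]\triangleleft z=[u\triangleleft x,y,z]-[u,x\cdot y,z]+[u,x,y\cdot z]$. Extensions. An extension of $A$ by $V$ is a short exact sequence $0\to V\xrightarrow{i}\widehat A\xrightarrow{p}A\to0$ of associative 2-algebras and strict homomorphisms ($\mathrm{Im}(i)=\mathrm{Ker}(p)$, $\mathrm{Ker}(i)=0$, $\mathrm{Im}(p)=A$);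 $\widehat A$ has structure $(\widehat d,\widehat\cdot,\widehat l_3)$, and $V=(V_1\xrightarrow{d_V}V_0)$ is regarded as a subcomplex of $\widehat A$ via $i$. It is an abelian extension if $V$ is abelian, i.e. the product of $V$ is zero and $l_3$ of $V$ is zero. A splitting $\sigma$ of $p$ is a pair of linear maps $\sigma_0:A_0\to\widehat A_0$, $\sigma_1:A_1\to\widehat A_1$ with $p_0\sigma_0=\mathrm{id}$, $p_1\sigma_1=\mathrm{id}$. The representation of $A$ on $V$ induced by an abelian extension with splitting $\sigma$ is $x\triangleright u=\sigma_0(x)\,\widehat\cdot\,u$, $x\triangleright m=\sigma_0(x)\,\widehat\cdot\,m$, $u\triangleleft x=u\,\widehat\cdot\,\sigma_0(x)$, $m\triangleleft x=m\,\widehat\cdot\,\sigma_0(x)$, $a\triangleright u=\sigma_1(a)\,\widehat\cdot\,u$, $u\triangleleft a=u\,\widehat\cdot\,\sigma_1(a)$, $[x,y,u]=\widehat l_3(\sigma_0(x),\sigma_0(y),u)$, $[x,u,y]=\widehat l_3(\sigma_0(x),u,\sigma_0(y))$, $[u,x,y]=\widehat l_3(u,\sigma_0(x),\sigma_0(y))$. Two extensions $0\to V\xrightarrow{i}\widehat A\xrightarrow{p}A\to0$ and $0\to V\xrightarrow{j}\widetilde A\xrightarrow{q}A\to0$ are equivalent if there is a homomorphism $F:\widehat A\to\widetilde A$ with $F\circ i=j$, $q\circ F=p$, and $F_2(i(u),\alpha)=0$ for all $u\in V_0$, $\alpha\in\widehat A_0$. Cohomology. $\mathbf H^2(A;V)=Z^2(A,V)/B^2(A,V)$.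 $Z^2(A,V)$ is the space of 2-cocycles: tuples of linear maps $\psi:A_1\to V_0$, $\omega:A_0\otimes A_0\to V_0$, $\mu:A_0\otimes A_1\to V_1$, $\nu:A_1\otimes A_0\to V_1$, $\theta:A_0^{\otimes3}\to V_1$ such that for all $x,y,z,t\in A_0$, $a,b\in A_1$: (1) $x\triangleright\psi(a)-\psi(x\cdot a)+\omega(x,da)-d_V\mu(x,a)=0$; (2) $\psi(a)\triangleleft x-\psi(a\cdot x)+\omega(da,x)-d_V\nu(a,x)=0$; (3) $a\triangleright\psi(b)+\nu(a,db)-\psi(a)\triangleleft b-\mu(da,b)=0$; (4) $\omega(x,y)\triangleleft z-x\triangleright\omega(y,z)+\omega(x\cdot y,z)-\omega(x,y\cdot z)=d_V\theta(x,y,z)+\psi(l_3(x,y,z))$; (5) $\omega(x,y)\triangleleft a-x\triangleright\mu(y,a)+\mu(x\cdot y,a)-\mu(x,y\cdot a)=\theta(x,y,da)+[x,y,\psi(a)]$; (6) $\mu(x,a)\triangleleft y-x\triangleright\nu(a,y)+\nu(x\cdot a,y)-\mu(x,a\cdot y)=\theta(x,da,y)+[x,\psi(a),y]$; (7) $\nu(a,x)\triangleleft y-a\triangleright\omega(x,y)+\nu(a\cdot x,y)-\nu(a,x\cdot y)=\theta(da,x,y)+[\psi(a),x,y]$; (8) $x\triangleright\theta(y,z,t)+\theta(x,y,z)\triangleleft t-\theta(x\cdot y,z,t)+\theta(x,y\cdot z,t)-\theta(x,y,z\cdot t)=\mu(x,l_3(y,z,t))+\nu(l_3(x,y,z),t)-[x,y,\omega(z,t)]-[\omega(x,y),z,t]+[x,\omega(y,z),t]$.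 $B^2(A,V)$ is the space of 2-coboundaries $(\psi,\omega,\mu,\nu,\theta)=D_1(\phi,\varphi,\chi)$, for linear maps $\phi:A_0\to V_0$, $\varphi:A_1\to V_1$, $\chi:A_0\otimes A_0\to V_1$, given by $\psi(a)=d_V\varphi(a)-\phi(da)$; $\omega(x,y)=x\triangleright\phi(y)-\phi(x)\triangleleft y-\phi(x\cdot y)+d_V\chi(x,y)$; $\mu(x,a)=x\triangleright\varphi(a)-\phi(x)\triangleleft a-\varphi(x\cdot a)+\chi(x,da)$; $\nu(a,x)=a\triangleright\phi(x)-\varphi(a)\triangleleft x-\varphi(a\cdot x)+\chi(da,x)$; $\theta(x,y,z)=x\triangleright\chi(y,z)-\chi(x,y)\triangleleft z+\chi(x,y\cdot z)-\chi(x\cdot y,z)-\varphi(l_3(x,y,z))+[x,y,\phi(z)]+[x,\phi(y),z]+[\phi(x),y,z]$.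
   Formalization: Signs corrected in the representation's third group, the last homomorphism equation, the coboundaries and (8); the actions on V are chain maps; in abelian extensions l_3 vanishes with two arguments in V; in equivalences F_2 vanishes when either argument is in V. *)

theory Defs
  imports Complex_Main "HOL-Library.Product_Plus"
begin

text \<open>
  A vector space over the field \<open>'k\<close> is a subspace of an ambient vector space that lives on a
  whole type.  Carriers are sets because the extensions of an algebra range over varying vector
  spaces.  Maps are total functions of which only the values on the carriers matter.
\<close>

definition linear_on ::
  "('k::field \<Rightarrow> 'a::ab_group_add \<Rightarrow> 'a) \<Rightarrow> ('k \<Rightarrow> 'b::ab_group_add \<Rightarrow> 'b) \<Rightarrow>
   'a set \<Rightarrow> 'b set \<Rightarrow> ('a \<Rightarrow> 'b) \<Rightarrow> bool" where
  "linear_on s t S T f \<longleftrightarrow>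
     (\<forall>x\<in>S. f x \<in> T) \<and>
     (\<forall>x\<in>S. \<forall>y\<in>S. f (x + y) = f x + f y) \<and>
     (\<forall>c. \<forall>x\<in>S. f (s c x) = t c (f x))"

lemma linear_on_UNIV:
  assumes "vector_space s" "vector_space t"
  shows "linear_on s t UNIV UNIV f \<longleftrightarrow> Vector_Spaces.linear s t f"
  using assms by (auto simp: linear_on_def Vector_Spaces.linear_iff)

definition bilinear_on ::
  "('k::field \<Rightarrow> 'a::ab_group_add \<Rightarrow> 'a) \<Rightarrow> ('k \<Rightarrow> 'b::ab_group_add \<Rightarrow> 'b) \<Rightarrow>
   ('k \<Rightarrow> 'c::ab_group_add \<Rightarrow> 'c) \<Rightarrow>
   'a set \<Rightarrow> 'b set \<Rightarrow> 'c set \<Rightarrow> ('a \<Rightarrow> 'b \<Rightarrow> 'c) \<Rightarrow> bool" where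
  "bilinear_on s t r S T R f \<longleftrightarrow>
     (\<forall>x\<in>S. linear_on t r T R (f x)) \<and>
     (\<forall>y\<in>T. linear_on s r S R (\<lambda>x. f x y))"

definition trilinear_on ::
  "('k::field \<Rightarrow> 'a::ab_group_add \<Rightarrow> 'a) \<Rightarrow> ('k \<Rightarrow> 'b::ab_group_add \<Rightarrow> 'b) \<Rightarrow>
   ('k \<Rightarrow> 'c::ab_group_add \<Rightarrow> 'c) \<Rightarrow> ('k \<Rightarrow> 'd::ab_group_add \<Rightarrow> 'd) \<Rightarrow>
   'a set \<Rightarrow> 'b set \<Rightarrow> 'c set \<Rightarrow> 'd set \<Rightarrow> ('a \<Rightarrow> 'b \<Rightarrow> 'c \<Rightarrow> 'd) \<Rightarrow> bool" where
  "trilinear_on s t r q S T R Q f \<longleftrightarrow>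
     (\<forall>x\<in>S. bilinear_on t r q T R Q (f x)) \<and>
     (\<forall>y\<in>T. \<forall>z\<in>R. linear_on s q S Q (\<lambda>x. f x y z))"


section \<open>2-term complexes and associative 2-algebras\<close>

record ('k, 'x1, 'x0) complex2 =
  scale1 :: "'k \<Rightarrow> 'x1 \<Rightarrow> 'x1"
  scale0 :: "'k \<Rightarrow> 'x0 \<Rightarrow> 'x0"
  space1 :: "'x1 set"
  space0 :: "'x0 set"
  bdry :: "'x1 \<Rightarrow> 'x0"

locale two_term_complex =
  fixes C :: "('k::field, 'x1::ab_group_add, 'x0::ab_group_add, 'm) complex2_scheme"
  assumes vector_space1: "vector_space (scale1 C)"
    and vector_space0: "vector_space (scale0 C)"
    and subspace1: "module.subspace (scale1 C) (space1 C)"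
    and subspace0: "module.subspace (scale0 C) (space0 C)"
    and bdry_linear: "linear_on (scale1 C) (scale0 C) (space1 C) (space0 C) (bdry C)"

text \<open>\<open>mul00\<close>, \<open>mul01\<close>, \<open>mul10\<close> are the three components \<open>A\<^sub>i \<otimes> A\<^sub>j \<rightarrow> A\<^bsub>i+j\<^esub>\<close> of the product.\<close>

record ('k, 'x1, 'x0) two_alg = "('k, 'x1, 'x0) complex2" +
  mul00 :: "'x0 \<Rightarrow> 'x0 \<Rightarrow> 'x0"
  mul01 :: "'x0 \<Rightarrow> 'x1 \<Rightarrow> 'x1"
  mul10 :: "'x1 \<Rightarrow> 'x0 \<Rightarrow> 'x1"
  l3 :: "'x0 \<Rightarrow> 'x0 \<Rightarrow> 'x0 \<Rightarrow> 'x1"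

locale assoc2_algebra = two_term_complex A
  for A :: "('k::field, 'x1::ab_group_add, 'x0::ab_group_add) two_alg" +
  assumes mul00_bilinear: "bilinear_on (scale0 A) (scale0 A) (scale0 A)
      (space0 A) (space0 A) (space0 A) (mul00 A)"
    and mul01_bilinear: "bilinear_on (scale0 A) (scale1 A) (scale1 A)
      (space0 A) (space1 A) (space1 A) (mul01 A)"
    and mul10_bilinear: "bilinear_on (scale1 A) (scale0 A) (scale1 A)
      (space1 A) (space0 A) (space1 A) (mul10 A)"
    and l3_trilinear: "trilinear_on (scale0 A) (scale0 A) (scale0 A) (scale1 A)
      (space0 A) (space0 A) (space0 A) (space1 A) (l3 A)"
    and ax_a: "\<lbrakk>x \<in> space0 A; a \<in> space1 A\<rbrakk> \<Longrightarrow>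
      bdry A (mul01 A x a) = mul00 A x (bdry A a)"
    and ax_b: "\<lbrakk>x \<in> space0 A; a \<in> space1 A\<rbrakk> \<Longrightarrow>
      bdry A (mul10 A a x) = mul00 A (bdry A a) x"
    and ax_c: "\<lbrakk>a \<in> space1 A; b \<in> space1 A\<rbrakk> \<Longrightarrow>
      mul01 A (bdry A a) b = mul10 A a (bdry A b)"
    and ax_d: "\<lbrakk>x \<in> space0 A; y \<in> space0 A; z \<in> space0 A\<rbrakk> \<Longrightarrow>
      bdry A (l3 A x y z) = mul00 A (mul00 A x y) z - mul00 A x (mul00 A y z)"
    and ax_e1: "\<lbrakk>x \<in> space0 A; y \<in> space0 A; a \<in> space1 A\<rbrakk> \<Longrightarrow>
      l3 A x y (bdry A a) = mul01 A (mul00 A x y) a - mul01 A x (mul01 A y a)"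
    and ax_e2: "\<lbrakk>x \<in> space0 A; y \<in> space0 A; a \<in> space1 A\<rbrakk> \<Longrightarrow>
      l3 A x (bdry A a) y = mul10 A (mul01 A x a) y - mul01 A x (mul10 A a y)"
    and ax_e3: "\<lbrakk>x \<in> space0 A; y \<in> space0 A; a \<in> space1 A\<rbrakk> \<Longrightarrow>
      l3 A (bdry A a) x y = mul10 A (mul10 A a x) y - mul10 A a (mul00 A x y)"
    and ax_f: "\<lbrakk>x \<in> space0 A; y \<in> space0 A; z \<in> space0 A; t \<in> space0 A\<rbrakk> \<Longrightarrow>
      mul01 A x (l3 A y z t) + mul10 A (l3 A x y z) t
        = l3 A (mul00 A x y) z t - l3 A x (mul00 A y z) t + l3 A x y (mul00 A z t)"


section \<open>Homomorphisms\<close>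

text \<open>
  The sign on the right-hand side of \<open>hom_l3\<close> is the one compatible with \<open>hom_mul00\<close>, \<open>hom_mul01\<close>
  and \<open>hom_mul10\<close>: these determine \<open>F\<^sub>1 (l3(x,y,da)) - l3'(F\<^sub>0 x, F\<^sub>0 y, F\<^sub>0 da)\<close> through (e1).
\<close>

record ('x1, 'x0, 'y1, 'y0) hom =
  hom0 :: "'x0 \<Rightarrow> 'y0"
  hom1 :: "'x1 \<Rightarrow> 'y1"
  hom2 :: "'x0 \<Rightarrow> 'x0 \<Rightarrow> 'y1"

locale assoc2_hom = A: assoc2_algebra A + B: assoc2_algebra B
  for A :: "('k::field, 'x1::ab_group_add, 'x0::ab_group_add) two_alg"
    and B :: "('k, 'y1::ab_group_add, 'y0::ab_group_add) two_alg" +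
  fixes F :: "('x1, 'x0, 'y1, 'y0) hom"
  assumes hom0_linear: "linear_on (scale0 A) (scale0 B) (space0 A) (space0 B) (hom0 F)"
    and hom1_linear: "linear_on (scale1 A) (scale1 B) (space1 A) (space1 B) (hom1 F)"
    and hom2_bilinear: "bilinear_on (scale0 A) (scale0 A) (scale1 B)
      (space0 A) (space0 A) (space1 B) (hom2 F)"
    and hom_bdry: "a \<in> space1 A \<Longrightarrow> hom0 F (bdry A a) = bdry B (hom1 F a)"
    and hom_mul00: "\<lbrakk>x \<in> space0 A; y \<in> space0 A\<rbrakk> \<Longrightarrow>
      hom0 F (mul00 A x y) - mul00 B (hom0 F x) (hom0 F y) = bdry B (hom2 F x y)"
    and hom_mul01: "\<lbrakk>x \<in> space0 A; a \<in> space1 A\<rbrakk> \<Longrightarrow>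
      hom1 F (mul01 A x a) - mul01 B (hom0 F x) (hom1 F a) = hom2 F x (bdry A a)"
    and hom_mul10: "\<lbrakk>x \<in> space0 A; a \<in> space1 A\<rbrakk> \<Longrightarrow>
      hom1 F (mul10 A a x) - mul10 B (hom1 F a) (hom0 F x) = hom2 F (bdry A a) x"
    and hom_l3: "\<lbrakk>x \<in> space0 A; y \<in> space0 A; z \<in> space0 A\<rbrakk> \<Longrightarrow>
      hom1 F (l3 A x y z) - l3 B (hom0 F x) (hom0 F y) (hom0 F z)
        = - (hom2 F x (mul00 A y z) - hom2 F (mul00 A x y) z
             + mul01 B (hom0 F x) (hom2 F y z) - mul10 B (hom2 F x y) (hom0 F z))"

locale strict_hom = assoc2_hom +
  assumes hom2_zero: "\<lbrakk>x \<in> space0 A; y \<in> space0 A\<rbrakk> \<Longrightarrow> hom2 F x y = 0"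

definition hom_comp ::
  "('y1, 'y0, 'z1, 'z0) hom \<Rightarrow> ('x1, 'x0, 'y1, 'y0) hom \<Rightarrow> ('x1, 'x0, 'z1::plus, 'z0) hom" where
  "hom_comp G F = \<lparr>
     hom0 = hom0 G \<circ> hom0 F,
     hom1 = hom1 G \<circ> hom1 F,
     hom2 = (\<lambda>x y. hom2 G (hom0 F x) (hom0 F y) + hom1 G (hom2 F x y))\<rparr>"

text \<open>Equality of homomorphisms with source \<open>A\<close>, i.e. agreement on the carriers.\<close>

definition hom_eq ::
  "('k, 'x1, 'x0, 'm) complex2_scheme \<Rightarrow>
   ('x1, 'x0, 'y1, 'y0) hom \<Rightarrow> ('x1, 'x0, 'y1, 'y0) hom \<Rightarrow> bool" where
  "hom_eq A F G \<longleftrightarrow>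
     (\<forall>x\<in>space0 A. hom0 F x = hom0 G x) \<and>
     (\<forall>a\<in>space1 A. hom1 F a = hom1 G a) \<and>
     (\<forall>x\<in>space0 A. \<forall>y\<in>space0 A. hom2 F x y = hom2 G x y)"


section \<open>Representations\<close>

text \<open>
  The left and right actions are written \<open>lact\<close> and \<open>ract\<close>; the index gives the degrees of the two
  arguments, in the order in which they are written.  The brackets \<open>[x,y,u]\<close>, \<open>[x,u,y]\<close>, \<open>[u,x,y]\<close>
  are \<open>br_aav V x y u\<close>, \<open>br_ava V x u y\<close>, \<open>br_vaa V u x y\<close>.
\<close>

record ('k, 'v1, 'v0, 'a1, 'a0) rep = "('k, 'v1, 'v0) complex2" +
  lact00 :: "'a0 \<Rightarrow> 'v0 \<Rightarrow> 'v0"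
  lact01 :: "'a0 \<Rightarrow> 'v1 \<Rightarrow> 'v1"
  lact10 :: "'a1 \<Rightarrow> 'v0 \<Rightarrow> 'v1"
  ract00 :: "'v0 \<Rightarrow> 'a0 \<Rightarrow> 'v0"
  ract10 :: "'v1 \<Rightarrow> 'a0 \<Rightarrow> 'v1"
  ract01 :: "'v0 \<Rightarrow> 'a1 \<Rightarrow> 'v1"
  br_aav :: "'a0 \<Rightarrow> 'a0 \<Rightarrow> 'v0 \<Rightarrow> 'v1"
  br_ava :: "'a0 \<Rightarrow> 'v0 \<Rightarrow> 'a0 \<Rightarrow> 'v1"
  br_vaa :: "'v0 \<Rightarrow> 'a0 \<Rightarrow> 'a0 \<Rightarrow> 'v1"

text \<open>
  The assumptions \<open>chain_\<dots>\<close> say that the two actions \<open>A \<otimes> V \<rightarrow> V\<close> and \<open>V \<otimes> A \<rightarrow> V\<close> are maps of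
  complexes.  The sign in the assumptions \<open>assoc_vaa\<dots>\<close> is the one satisfied by
  \<open>[u,x,y] = l3(u,x,y)\<close> in an extension: \<open>d l3(u,x,y) = (u x) y - u (x y)\<close>.
\<close>

locale alg_representation = A: assoc2_algebra A + V: two_term_complex V
  for A :: "('k::field, 'a1::ab_group_add, 'a0::ab_group_add) two_alg"
    and V :: "('k, 'v1::ab_group_add, 'v0::ab_group_add, 'a1, 'a0) rep" +
  assumes lact00_bilinear: "bilinear_on (scale0 A) (scale0 V) (scale0 V)
      (space0 A) (space0 V) (space0 V) (lact00 V)"
    and lact01_bilinear: "bilinear_on (scale0 A) (scale1 V) (scale1 V)
      (space0 A) (space1 V) (space1 V) (lact01 V)"
    and lact10_bilinear: "bilinear_on (scale1 A) (scale0 V) (scale1 V)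
      (space1 A) (space0 V) (space1 V) (lact10 V)"
    and ract00_bilinear: "bilinear_on (scale0 V) (scale0 A) (scale0 V)
      (space0 V) (space0 A) (space0 V) (ract00 V)"
    and ract10_bilinear: "bilinear_on (scale1 V) (scale0 A) (scale1 V)
      (space1 V) (space0 A) (space1 V) (ract10 V)"
    and ract01_bilinear: "bilinear_on (scale0 V) (scale1 A) (scale1 V)
      (space0 V) (space1 A) (space1 V) (ract01 V)"
    and br_aav_trilinear: "trilinear_on (scale0 A) (scale0 A) (scale0 V) (scale1 V)
      (space0 A) (space0 A) (space0 V) (space1 V) (br_aav V)"
    and br_ava_trilinear: "trilinear_on (scale0 A) (scale0 V) (scale0 A) (scale1 V)
      (space0 A) (space0 V) (space0 A) (space1 V) (br_ava V)"
    and br_vaa_trilinear: "trilinear_on (scale0 V) (scale0 A) (scale0 A) (scale1 V)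
      (space0 V) (space0 A) (space0 A) (space1 V) (br_vaa V)"
    and chain_lact01: "\<lbrakk>x \<in> space0 A; m \<in> space1 V\<rbrakk> \<Longrightarrow>
      bdry V (lact01 V x m) = lact00 V x (bdry V m)"
    and chain_lact10: "\<lbrakk>a \<in> space1 A; u \<in> space0 V\<rbrakk> \<Longrightarrow>
      bdry V (lact10 V a u) = lact00 V (bdry A a) u"
    and chain_lact11: "\<lbrakk>a \<in> space1 A; m \<in> space1 V\<rbrakk> \<Longrightarrow>
      lact01 V (bdry A a) m = lact10 V a (bdry V m)"
    and chain_ract10: "\<lbrakk>x \<in> space0 A; m \<in> space1 V\<rbrakk> \<Longrightarrow>
      bdry V (ract10 V m x) = ract00 V (bdry V m) x"
    and chain_ract01: "\<lbrakk>a \<in> space1 A; u \<in> space0 V\<rbrakk> \<Longrightarrow>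
      bdry V (ract01 V u a) = ract00 V u (bdry A a)"
    and chain_ract11: "\<lbrakk>a \<in> space1 A; m \<in> space1 V\<rbrakk> \<Longrightarrow>
      ract10 V m (bdry A a) = ract01 V (bdry V m) a"
    and assoc_aav0: "\<lbrakk>x \<in> space0 A; y \<in> space0 A; u \<in> space0 V\<rbrakk> \<Longrightarrow>
      lact00 V (mul00 A x y) u - lact00 V x (lact00 V y u) = bdry V (br_aav V x y u)"
    and assoc_aav1: "\<lbrakk>x \<in> space0 A; y \<in> space0 A; m \<in> space1 V\<rbrakk> \<Longrightarrow>
      lact01 V (mul00 A x y) m - lact01 V x (lact01 V y m) = br_aav V x y (bdry V m)"
    and assoc_aav2: "\<lbrakk>x \<in> space0 A; a \<in> space1 A; u \<in> space0 V\<rbrakk> \<Longrightarrow>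
      lact10 V (mul01 A x a) u - lact01 V x (lact10 V a u) = br_aav V x (bdry A a) u"
    and assoc_aav3: "\<lbrakk>x \<in> space0 A; a \<in> space1 A; u \<in> space0 V\<rbrakk> \<Longrightarrow>
      lact10 V (mul10 A a x) u - lact10 V a (lact00 V x u) = br_aav V (bdry A a) x u"
    and assoc_ava0: "\<lbrakk>x \<in> space0 A; y \<in> space0 A; u \<in> space0 V\<rbrakk> \<Longrightarrow>
      ract00 V (lact00 V x u) y - lact00 V x (ract00 V u y) = bdry V (br_ava V x u y)"
    and assoc_ava1: "\<lbrakk>x \<in> space0 A; y \<in> space0 A; m \<in> space1 V\<rbrakk> \<Longrightarrow>
      ract10 V (lact01 V x m) y - lact01 V x (ract10 V m y) = br_ava V x (bdry V m) y"
    and assoc_ava2: "\<lbrakk>x \<in> space0 A; a \<in> space1 A; u \<in> space0 V\<rbrakk> \<Longrightarrow>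
      ract01 V (lact00 V x u) a - lact01 V x (ract01 V u a) = br_ava V x u (bdry A a)"
    and assoc_ava3: "\<lbrakk>y \<in> space0 A; a \<in> space1 A; u \<in> space0 V\<rbrakk> \<Longrightarrow>
      ract10 V (lact10 V a u) y - lact10 V a (ract00 V u y) = br_ava V (bdry A a) u y"
    and assoc_vaa0: "\<lbrakk>x \<in> space0 A; y \<in> space0 A; u \<in> space0 V\<rbrakk> \<Longrightarrow>
      ract00 V (ract00 V u x) y - ract00 V u (mul00 A x y) = bdry V (br_vaa V u x y)"
    and assoc_vaa1: "\<lbrakk>x \<in> space0 A; y \<in> space0 A; m \<in> space1 V\<rbrakk> \<Longrightarrow>
      ract10 V (ract10 V m x) y - ract10 V m (mul00 A x y) = br_vaa V (bdry V m) x y"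
    and assoc_vaa2: "\<lbrakk>x \<in> space0 A; a \<in> space1 A; u \<in> space0 V\<rbrakk> \<Longrightarrow>
      ract01 V (ract00 V u x) a - ract01 V u (mul01 A x a) = br_vaa V u x (bdry A a)"
    and assoc_vaa3: "\<lbrakk>x \<in> space0 A; a \<in> space1 A; u \<in> space0 V\<rbrakk> \<Longrightarrow>
      ract10 V (ract01 V u a) x - ract01 V u (mul10 A a x) = br_vaa V u (bdry A a) x"
    and pentagon_avaa:
      "\<lbrakk>x \<in> space0 A; y \<in> space0 A; z \<in> space0 A; u \<in> space0 V\<rbrakk> \<Longrightarrow>
      lact01 V x (br_vaa V u y z) + ract10 V (br_ava V x u y) z
        = br_vaa V (lact00 V x u) y z - br_ava V x (ract00 V u y) z + br_ava V x u (mul00 A y z)"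
    and pentagon_aava:
      "\<lbrakk>x \<in> space0 A; y \<in> space0 A; z \<in> space0 A; u \<in> space0 V\<rbrakk> \<Longrightarrow>
      lact01 V x (br_ava V y u z) + ract10 V (br_aav V x y u) z
        = br_ava V (mul00 A x y) u z - br_ava V x (lact00 V y u) z + br_aav V x y (ract00 V u z)"
    and pentagon_aaav:
      "\<lbrakk>x \<in> space0 A; y \<in> space0 A; z \<in> space0 A; u \<in> space0 V\<rbrakk> \<Longrightarrow>
      lact01 V x (br_aav V y z u) + lact10 V (l3 A x y z) u
        = br_aav V (mul00 A x y) z u - br_aav V x (mul00 A y z) u + br_aav V x y (lact00 V z u)"
    and pentagon_vaaa:
      "\<lbrakk>x \<in> space0 A; y \<in> space0 A; z \<in> space0 A; u \<in> space0 V\<rbrakk> \<Longrightarrow>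
      ract01 V u (l3 A x y z) + ract10 V (br_vaa V u x y) z
        = br_vaa V (ract00 V u x) y z - br_vaa V u (mul00 A x y) z + br_vaa V u x (mul00 A y z)"


section \<open>Extensions\<close>

text \<open>An extension \<open>0 \<rightarrow> B \<rightarrow> total \<rightarrow> A \<rightarrow> 0\<close>, with total space on the types \<open>'e1\<close>, \<open>'e0\<close>.\<close>

record ('k, 'b1, 'b0, 'e1, 'e0, 'a1, 'a0) ext =
  total :: "('k, 'e1, 'e0) two_alg"
  incl :: "('b1, 'b0, 'e1, 'e0) hom"
  proj :: "('e1, 'e0, 'a1, 'a0) hom"

locale extension =
  i: strict_hom B "total E" "incl E" + p: strict_hom "total E" A "proj E"
  for A :: "('k::field, 'a1::ab_group_add, 'a0::ab_group_add) two_alg"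
    and B :: "('k, 'b1::ab_group_add, 'b0::ab_group_add) two_alg"
    and E :: "('k, 'b1, 'b0, 'e1::ab_group_add, 'e0::ab_group_add, 'a1, 'a0) ext" +
  assumes ker_incl0: "{u \<in> space0 B. hom0 (incl E) u = 0} = {0}"
    and ker_incl1: "{m \<in> space1 B. hom1 (incl E) m = 0} = {0}"
    and exact0: "hom0 (incl E) ` space0 B = {\<alpha> \<in> space0 (total E). hom0 (proj E) \<alpha> = 0}"
    and exact1: "hom1 (incl E) ` space1 B = {\<beta> \<in> space1 (total E). hom1 (proj E) \<beta> = 0}"
    and im_proj0: "hom0 (proj E) ` space0 (total E) = space0 A"
    and im_proj1: "hom1 (proj E) ` space1 (total E) = space1 A"

text \<open>The complex \<open>V\<close> as an associative 2-algebra with zero product and zero \<open>l3\<close>.\<close>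

definition abelian_alg ::
  "('k, 'v1::zero, 'v0::zero, 'm) complex2_scheme \<Rightarrow> ('k, 'v1, 'v0) two_alg" where
  "abelian_alg V = \<lparr>
     scale1 = scale1 V, scale0 = scale0 V, space1 = space1 V, space0 = space0 V, bdry = bdry V,
     mul00 = (\<lambda>_ _. 0), mul01 = (\<lambda>_ _. 0), mul10 = (\<lambda>_ _. 0), l3 = (\<lambda>_ _ _. 0)\<rparr>"

text \<open>
  \<open>V\<close> is abelian as an ideal of the total algebra: the product vanishes on \<open>V \<otimes> V\<close> (since
  the inclusion is a strict homomorphism from \<open>abelian_alg V\<close>), and \<open>l3\<close> vanishes as soon as two
  of its arguments lie in \<open>V\<close>.  The latter is not implied by the vanishing of \<open>l3\<close> on three
  arguments from \<open>V\<close>; without it the brackets of the induced representation would depend on the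
  splitting.
\<close>

locale abelian_extension = extension A "abelian_alg V" E
  for A :: "('k::field, 'a1::ab_group_add, 'a0::ab_group_add) two_alg"
    and V :: "('k, 'v1::ab_group_add, 'v0::ab_group_add, 'a1, 'a0) rep"
    and E :: "('k, 'v1, 'v0, 'e1::ab_group_add, 'e0::ab_group_add, 'a1, 'a0) ext" +
  assumes l3_vva: "\<lbrakk>u \<in> space0 V; v \<in> space0 V; \<alpha> \<in> space0 (total E)\<rbrakk> \<Longrightarrow>
      l3 (total E) (hom0 (incl E) u) (hom0 (incl E) v) \<alpha> = 0"
    and l3_vav: "\<lbrakk>u \<in> space0 V; v \<in> space0 V; \<alpha> \<in> space0 (total E)\<rbrakk> \<Longrightarrow>
      l3 (total E) (hom0 (incl E) u) \<alpha> (hom0 (incl E) v) = 0"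
    and l3_avv: "\<lbrakk>u \<in> space0 V; v \<in> space0 V; \<alpha> \<in> space0 (total E)\<rbrakk> \<Longrightarrow>
      l3 (total E) \<alpha> (hom0 (incl E) u) (hom0 (incl E) v) = 0"

definition splitting ::
  "('k::field, 'a1::ab_group_add, 'a0::ab_group_add) two_alg \<Rightarrow>
   ('k, 'b1, 'b0, 'e1::ab_group_add, 'e0::ab_group_add, 'a1, 'a0) ext \<Rightarrow>
   ('a0 \<Rightarrow> 'e0) \<Rightarrow> ('a1 \<Rightarrow> 'e1) \<Rightarrow> bool" where
  "splitting A E \<sigma>0 \<sigma>1 \<longleftrightarrow>
     linear_on (scale0 A) (scale0 (total E)) (space0 A) (space0 (total E)) \<sigma>0 \<and>
     linear_on (scale1 A) (scale1 (total E)) (space1 A) (space1 (total E)) \<sigma>1 \<and>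
     (\<forall>x\<in>space0 A. hom0 (proj E) (\<sigma>0 x) = x) \<and>
     (\<forall>a\<in>space1 A. hom1 (proj E) (\<sigma>1 a) = a)"

text \<open>The representation induced by the extension \<open>E\<close> and the splitting is the given one.\<close>

definition induces ::
  "('k, 'a1, 'a0) two_alg \<Rightarrow> ('k, 'v1, 'v0, 'a1, 'a0) rep \<Rightarrow>
   ('k, 'v1, 'v0, 'e1, 'e0, 'a1, 'a0) ext \<Rightarrow> ('a0 \<Rightarrow> 'e0) \<Rightarrow> ('a1 \<Rightarrow> 'e1) \<Rightarrow> bool" where
  "induces A V E \<sigma>0 \<sigma>1 \<longleftrightarrow>
     (\<forall>x\<in>space0 A. \<forall>u\<in>space0 V.
        hom0 (incl E) (lact00 V x u) = mul00 (total E) (\<sigma>0 x) (hom0 (incl E) u) \<and>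
        hom0 (incl E) (ract00 V u x) = mul00 (total E) (hom0 (incl E) u) (\<sigma>0 x)) \<and>
     (\<forall>x\<in>space0 A. \<forall>m\<in>space1 V.
        hom1 (incl E) (lact01 V x m) = mul01 (total E) (\<sigma>0 x) (hom1 (incl E) m) \<and>
        hom1 (incl E) (ract10 V m x) = mul10 (total E) (hom1 (incl E) m) (\<sigma>0 x)) \<and>
     (\<forall>a\<in>space1 A. \<forall>u\<in>space0 V.
        hom1 (incl E) (lact10 V a u) = mul10 (total E) (\<sigma>1 a) (hom0 (incl E) u) \<and>
        hom1 (incl E) (ract01 V u a) = mul01 (total E) (hom0 (incl E) u) (\<sigma>1 a)) \<and>
     (\<forall>x\<in>space0 A. \<forall>y\<in>space0 A. \<forall>u\<in>space0 V.
        hom1 (incl E) (br_aav V x y u) = l3 (total E) (\<sigma>0 x) (\<sigma>0 y) (hom0 (incl E) u) \<and>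
        hom1 (incl E) (br_ava V x u y) = l3 (total E) (\<sigma>0 x) (hom0 (incl E) u) (\<sigma>0 y) \<and>
        hom1 (incl E) (br_vaa V u x y) = l3 (total E) (hom0 (incl E) u) (\<sigma>0 x) (\<sigma>0 y))"

definition abelian_extensions ::
  "('k::field, 'a1::ab_group_add, 'a0::ab_group_add) two_alg \<Rightarrow>
   ('k, 'v1::ab_group_add, 'v0::ab_group_add, 'a1, 'a0) rep \<Rightarrow>
   ('k, 'v1, 'v0, 'e1::ab_group_add, 'e0::ab_group_add, 'a1, 'a0) ext set" where
  "abelian_extensions A V =
     {E. abelian_extension A V E \<and> (\<exists>\<sigma>0 \<sigma>1. splitting A E \<sigma>0 \<sigma>1 \<and> induces A V E \<sigma>0 \<sigma>1)}"

text \<open>\<open>F\<^sub>2\<close> is not symmetric, so its vanishing on \<open>V\<close> is required in both arguments.\<close>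

definition ext_equivalent ::
  "('k::field, 'b1::ab_group_add, 'b0::ab_group_add) two_alg \<Rightarrow>
   ('k, 'b1, 'b0, 'e1::ab_group_add, 'e0::ab_group_add, 'a1::ab_group_add, 'a0) ext \<Rightarrow>
   ('k, 'b1, 'b0, 'f1::ab_group_add, 'f0::ab_group_add, 'a1, 'a0) ext \<Rightarrow> bool" where
  "ext_equivalent B E E' \<longleftrightarrow>
     (\<exists>F. assoc2_hom (total E) (total E') F \<and>
        hom_eq B (hom_comp F (incl E)) (incl E') \<and>
        hom_eq (total E) (hom_comp (proj E') F) (proj E) \<and>
        (\<forall>u\<in>space0 B. \<forall>\<alpha>\<in>space0 (total E).
           hom2 F (hom0 (incl E) u) \<alpha> = 0 \<and> hom2 F \<alpha> (hom0 (incl E) u) = 0))"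

definition ext_rel ::
  "('k::field, 'a1::ab_group_add, 'a0::ab_group_add) two_alg \<Rightarrow>
   ('k, 'v1::ab_group_add, 'v0::ab_group_add, 'a1, 'a0) rep \<Rightarrow>
   ('k, 'v1, 'v0, 'e1::ab_group_add, 'e0::ab_group_add, 'a1, 'a0) ext rel" where
  "ext_rel A V =
     {(E, E'). E \<in> abelian_extensions A V \<and> E' \<in> abelian_extensions A V \<and>
        ext_equivalent (abelian_alg V) E E'}"


section \<open>Second cohomology\<close>

record ('a1, 'a0, 'v1, 'v0) cochain =
  psi :: "'a1 \<Rightarrow> 'v0"
  omega :: "'a0 \<Rightarrow> 'a0 \<Rightarrow> 'v0"
  mu :: "'a0 \<Rightarrow> 'a1 \<Rightarrow> 'v1"
  nu :: "'a1 \<Rightarrow> 'a0 \<Rightarrow> 'v1"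
  theta :: "'a0 \<Rightarrow> 'a0 \<Rightarrow> 'a0 \<Rightarrow> 'v1"

text \<open>
  The cocycle conditions express the axioms of an associative 2-algebra for
  \<open>A \<oplus> V\<close> with structure maps twisted by \<open>(\<psi>, \<omega>, \<mu>, \<nu>, \<theta>)\<close>.  The signs on the right-hand side
  of \<open>cocycle8\<close> are those obtained from axiom (f).
\<close>

locale two_cocycle =
  fixes A :: "('k::field, 'a1::ab_group_add, 'a0::ab_group_add) two_alg"
    and V :: "('k, 'v1::ab_group_add, 'v0::ab_group_add, 'a1, 'a0) rep"
    and c :: "('a1, 'a0, 'v1, 'v0) cochain"
  assumes psi_linear: "linear_on (scale1 A) (scale0 V) (space1 A) (space0 V) (psi c)"
    and omega_bilinear: "bilinear_on (scale0 A) (scale0 A) (scale0 V)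
      (space0 A) (space0 A) (space0 V) (omega c)"
    and mu_bilinear: "bilinear_on (scale0 A) (scale1 A) (scale1 V)
      (space0 A) (space1 A) (space1 V) (mu c)"
    and nu_bilinear: "bilinear_on (scale1 A) (scale0 A) (scale1 V)
      (space1 A) (space0 A) (space1 V) (nu c)"
    and theta_trilinear: "trilinear_on (scale0 A) (scale0 A) (scale0 A) (scale1 V)
      (space0 A) (space0 A) (space0 A) (space1 V) (theta c)"
    and cocycle1: "\<lbrakk>x \<in> space0 A; a \<in> space1 A\<rbrakk> \<Longrightarrow>
      lact00 V x (psi c a) - psi c (mul01 A x a) + omega c x (bdry A a)
        - bdry V (mu c x a) = 0"
    and cocycle2: "\<lbrakk>x \<in> space0 A; a \<in> space1 A\<rbrakk> \<Longrightarrow>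
      ract00 V (psi c a) x - psi c (mul10 A a x) + omega c (bdry A a) x
        - bdry V (nu c a x) = 0"
    and cocycle3: "\<lbrakk>a \<in> space1 A; b \<in> space1 A\<rbrakk> \<Longrightarrow>
      lact10 V a (psi c b) + nu c a (bdry A b) - ract01 V (psi c a) b
        - mu c (bdry A a) b = 0"
    and cocycle4: "\<lbrakk>x \<in> space0 A; y \<in> space0 A; z \<in> space0 A\<rbrakk> \<Longrightarrow>
      ract00 V (omega c x y) z - lact00 V x (omega c y z)
        + omega c (mul00 A x y) z - omega c x (mul00 A y z)
        = bdry V (theta c x y z) + psi c (l3 A x y z)"
    and cocycle5: "\<lbrakk>x \<in> space0 A; y \<in> space0 A; a \<in> space1 A\<rbrakk> \<Longrightarrow>
      ract01 V (omega c x y) a - lact01 V x (mu c y a)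
        + mu c (mul00 A x y) a - mu c x (mul01 A y a)
        = theta c x y (bdry A a) + br_aav V x y (psi c a)"
    and cocycle6: "\<lbrakk>x \<in> space0 A; y \<in> space0 A; a \<in> space1 A\<rbrakk> \<Longrightarrow>
      ract10 V (mu c x a) y - lact01 V x (nu c a y)
        + nu c (mul01 A x a) y - mu c x (mul10 A a y)
        = theta c x (bdry A a) y + br_ava V x (psi c a) y"
    and cocycle7: "\<lbrakk>x \<in> space0 A; y \<in> space0 A; a \<in> space1 A\<rbrakk> \<Longrightarrow>
      ract10 V (nu c a x) y - lact10 V a (omega c x y)
        + nu c (mul10 A a x) y - nu c a (mul00 A x y)
        = theta c (bdry A a) x y + br_vaa V (psi c a) x y"
    and cocycle8: "\<lbrakk>x \<in> space0 A; y \<in> space0 A; z \<in> space0 A; t \<in> space0 A\<rbrakk> \<Longrightarrow>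
      lact01 V x (theta c y z t) + ract10 V (theta c x y z) t
        - theta c (mul00 A x y) z t + theta c x (mul00 A y z) t - theta c x y (mul00 A z t)
        = - (mu c x (l3 A y z t) + nu c (l3 A x y z) t
             - br_aav V x y (omega c z t) - br_vaa V (omega c x y) z t
             + br_ava V x (omega c y z) t)"

definition Z2 ::
  "('k::field, 'a1::ab_group_add, 'a0::ab_group_add) two_alg \<Rightarrow>
   ('k, 'v1::ab_group_add, 'v0::ab_group_add, 'a1, 'a0) rep \<Rightarrow>
   ('a1, 'a0, 'v1, 'v0) cochain set" where
  "Z2 A V = {c. two_cocycle A V c}"

text \<open>
  The coboundary \<open>D\<^sub>1(\<phi>, \<phi>', \<chi>)\<close> of \<open>\<phi> : A\<^sub>0 \<rightarrow> V\<^sub>0\<close>, \<open>\<phi>' : A\<^sub>1 \<rightarrow> V\<^sub>1\<close>, \<open>\<chi> : A\<^sub>0 \<otimes> A\<^sub>0 \<rightarrow> V\<^sub>1\<close>.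
  It is the difference of the cocycles of two extensions along an equivalence with components
  \<open>(\<phi>, \<phi>', \<chi>)\<close>.  In particular the right actions on \<open>\<phi>\<close> and \<open>\<phi>'\<close> enter with a plus sign, as in
  the Hochschild complex, and the Hochschild differential of \<open>\<chi>\<close> enters \<open>theta\<close> with a minus sign,
  as in \<open>hom_l3\<close>.
\<close>

definition D1 ::
  "('k, 'a1, 'a0) two_alg \<Rightarrow> ('k, 'v1::ab_group_add, 'v0::ab_group_add, 'a1, 'a0) rep \<Rightarrow>
   ('a0 \<Rightarrow> 'v0) \<Rightarrow> ('a1 \<Rightarrow> 'v1) \<Rightarrow> ('a0 \<Rightarrow> 'a0 \<Rightarrow> 'v1) \<Rightarrow> ('a1, 'a0, 'v1, 'v0) cochain" where
  "D1 A V \<phi> \<phi>' \<chi> = \<lparr>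
     psi = (\<lambda>a. bdry V (\<phi>' a) - \<phi> (bdry A a)),
     omega = (\<lambda>x y. lact00 V x (\<phi> y) + ract00 V (\<phi> x) y - \<phi> (mul00 A x y) + bdry V (\<chi> x y)),
     mu = (\<lambda>x a. lact01 V x (\<phi>' a) + ract01 V (\<phi> x) a - \<phi>' (mul01 A x a) + \<chi> x (bdry A a)),
     nu = (\<lambda>a x. lact10 V a (\<phi> x) + ract10 V (\<phi>' a) x - \<phi>' (mul10 A a x) + \<chi> (bdry A a) x),
     theta = (\<lambda>x y z. - (lact01 V x (\<chi> y z) - ract10 V (\<chi> x y) z
            + \<chi> x (mul00 A y z) - \<chi> (mul00 A x y) z) - \<phi>' (l3 A x y z)
        + br_aav V x y (\<phi> z) + br_ava V x (\<phi> y) z + br_vaa V (\<phi> x) y z)\<rparr>"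

text \<open>Equality of cochains, i.e. agreement on the carriers.\<close>

definition cochain_eq ::
  "('k, 'a1, 'a0) two_alg \<Rightarrow>
   ('a1, 'a0, 'v1, 'v0) cochain \<Rightarrow> ('a1, 'a0, 'v1, 'v0) cochain \<Rightarrow> bool" where
  "cochain_eq A c c' \<longleftrightarrow>
     (\<forall>a\<in>space1 A. psi c a = psi c' a) \<and>
     (\<forall>x\<in>space0 A. \<forall>y\<in>space0 A. omega c x y = omega c' x y) \<and>
     (\<forall>x\<in>space0 A. \<forall>a\<in>space1 A. mu c x a = mu c' x a) \<and>
     (\<forall>a\<in>space1 A. \<forall>x\<in>space0 A. nu c a x = nu c' a x) \<and>
     (\<forall>x\<in>space0 A. \<forall>y\<in>space0 A. \<forall>z\<in>space0 A. theta c x y z = theta c' x y z)"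

definition B2 ::
  "('k::field, 'a1::ab_group_add, 'a0::ab_group_add) two_alg \<Rightarrow>
   ('k, 'v1::ab_group_add, 'v0::ab_group_add, 'a1, 'a0) rep \<Rightarrow>
   ('a1, 'a0, 'v1, 'v0) cochain set" where
  "B2 A V = {c. \<exists>\<phi> \<phi>' \<chi>.
     linear_on (scale0 A) (scale0 V) (space0 A) (space0 V) \<phi> \<and>
     linear_on (scale1 A) (scale1 V) (space1 A) (space1 V) \<phi>' \<and>
     bilinear_on (scale0 A) (scale0 A) (scale1 V) (space0 A) (space0 A) (space1 V) \<chi> \<and>
     cochain_eq A c (D1 A V \<phi> \<phi>' \<chi>)}"

definition cochain_diff ::
  "('a1, 'a0, 'v1::minus, 'v0::minus) cochain \<Rightarrow> ('a1, 'a0, 'v1, 'v0) cochain \<Rightarrow>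
   ('a1, 'a0, 'v1, 'v0) cochain" where
  "cochain_diff c c' = \<lparr>
     psi = (\<lambda>a. psi c a - psi c' a),
     omega = (\<lambda>x y. omega c x y - omega c' x y),
     mu = (\<lambda>x a. mu c x a - mu c' x a),
     nu = (\<lambda>a x. nu c a x - nu c' a x),
     theta = (\<lambda>x y z. theta c x y z - theta c' x y z)\<rparr>"

definition cohomologous ::
  "('k::field, 'a1::ab_group_add, 'a0::ab_group_add) two_alg \<Rightarrow>
   ('k, 'v1::ab_group_add, 'v0::ab_group_add, 'a1, 'a0) rep \<Rightarrow>
   ('a1, 'a0, 'v1, 'v0) cochain rel" where
  "cohomologous A V = {(c, c'). c \<in> Z2 A V \<and> c' \<in> Z2 A V \<and> cochain_diff c c' \<in> B2 A V}"

text \<open>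
  The zero cochain is in \<open>B2\<close>, so cocycles that differ only outside the carriers of \<open>A\<close> have the
  same class.
\<close>

definition H2 ::
  "('k::field, 'a1::ab_group_add, 'a0::ab_group_add) two_alg \<Rightarrow>
   ('k, 'v1::ab_group_add, 'v0::ab_group_add, 'a1, 'a0) rep \<Rightarrow>
   ('a1, 'a0, 'v1, 'v0) cochain set set" where
  "H2 A V = Z2 A V // cohomologous A V"

text \<open>
  The cocycle of an extension and a splitting: the defect of the splitting from being a strict
  homomorphism of associative 2-algebras, read in \<open>V\<close> through the inclusion.
\<close>

definition extension_cocycle ::
  "('k, 'a1, 'a0) two_alg \<Rightarrow>
   ('k, 'v1, 'v0, 'e1::ab_group_add, 'e0::ab_group_add, 'a1, 'a0) ext \<Rightarrow>
   ('a0 \<Rightarrow> 'e0) \<Rightarrow> ('a1 \<Rightarrow> 'e1) \<Rightarrow> ('a1, 'a0, 'v1, 'v0) cochain \<Rightarrow> bool" where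
  "extension_cocycle A E \<sigma>0 \<sigma>1 c \<longleftrightarrow>
     (\<forall>a\<in>space1 A.
        hom0 (incl E) (psi c a) = bdry (total E) (\<sigma>1 a) - \<sigma>0 (bdry A a)) \<and>
     (\<forall>x\<in>space0 A. \<forall>y\<in>space0 A.
        hom0 (incl E) (omega c x y) = mul00 (total E) (\<sigma>0 x) (\<sigma>0 y) - \<sigma>0 (mul00 A x y)) \<and>
     (\<forall>x\<in>space0 A. \<forall>a\<in>space1 A.
        hom1 (incl E) (mu c x a) = mul01 (total E) (\<sigma>0 x) (\<sigma>1 a) - \<sigma>1 (mul01 A x a)) \<and>
     (\<forall>a\<in>space1 A. \<forall>x\<in>space0 A.
        hom1 (incl E) (nu c a x) = mul10 (total E) (\<sigma>1 a) (\<sigma>0 x) - \<sigma>1 (mul10 A a x)) \<and>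
     (\<forall>x\<in>space0 A. \<forall>y\<in>space0 A. \<forall>z\<in>space0 A.
        hom1 (incl E) (theta c x y z)
          = l3 (total E) (\<sigma>0 x) (\<sigma>0 y) (\<sigma>0 z) - \<sigma>1 (l3 A x y z))"

text \<open>
  The vector space on a type is large enough to contain a copy of \<open>S \<oplus> T\<close>.  This
  is used as a bound on the universe in which the total spaces of extensions are taken.
\<close>

definition embeds_sum ::
  "('k::field \<Rightarrow> 'a::ab_group_add \<Rightarrow> 'a) \<Rightarrow> 'a set \<Rightarrow>
   ('k \<Rightarrow> 'b::ab_group_add \<Rightarrow> 'b) \<Rightarrow> 'b set \<Rightarrow>
   ('k \<Rightarrow> 'e::ab_group_add \<Rightarrow> 'e) \<Rightarrow> bool" where
  "embeds_sum s S t T r \<longleftrightarrow>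
     vector_space r \<and>
     (\<exists>j. linear_on (\<lambda>c (x, u). (s c x, t c u)) r (S \<times> T) UNIV j \<and> inj_on j (S \<times> T))"

end

theory Submission
  imports Defs
begin

text \<open>
  A splitting \<open>\<sigma>\<close> of an abelian extension \<open>E\<close> identifies \<open>E\<close>, as a graded vector space, with
  \<open>A \<oplus> V\<close> through \<open>J (x, u) = \<sigma> x + i u\<close>.  Since \<open>V\<close> is an abelian ideal, multilinearity
  determines the structure of \<open>E\<close> in these coordinates: it is the semidirect structure given by
  the representation, plus a correction that depends only on the components in \<open>A\<close>.  The
  correction is a cochain \<open>c = (\<psi>, \<omega>, \<mu>, \<nu>, \<theta>)\<close>, the defect of \<open>\<sigma>\<close> from being a strict
  homomorphism.  The locale \<open>twisted_sum\<close> describes this situation and \<open>extension_coordinates\<close>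
  adds the inclusion and the projection.  Everything is then read off in coordinates.

  \<^item> The axioms of an associative 2-algebra for \<open>E\<close> are equivalent to the cocycle conditions for
    \<open>c\<close> (\<open>algebra_if_cocycle\<close>, \<open>cocycle_if_algebra\<close>).
  \<^item> Two splittings differ by a linear map into \<open>V\<close>, on which the products and brackets with \<open>V\<close>
    vanish; so every splitting induces the given representation (\<open>induces_if_splitting\<close>), and every
    splitting provides coordinates (\<open>abelian_extension_coordinates\<close>).
  \<^item> An equivalence of two extensions with cochains \<open>c\<close> and \<open>d\<close> has the form
    \<open>F\<^sub>0 (x, u) = (x, u + f x)\<close>, \<open>F\<^sub>1 (a, m) = (a, m + g a)\<close>, \<open>F\<^sub>2 ((x, u), (y, v)) = (0, h x y)\<close>, and
    the conditions on a homomorphism say exactly that \<open>c - d\<close> is the coboundary of \<open>(f, g, h)\<close>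
    (\<open>coboundary_if_equivalent\<close>, \<open>equivalent_if_coboundary\<close>).
  \<^item> Every cocycle twists \<open>A \<oplus> V\<close> into an extension, which is carried to the prescribed universe
    along the given embeddings (\<open>extension_of_cocycle\<close>).

  Hence the relation that pairs an extension with the cochains of its coordinates is total on
  extensions and on cocycles, and matches equivalence with being cohomologous.  As being
  cohomologous is an equivalence relation, this induces a bijection of the quotients (\<open>quotient_bijection\<close>).
\<close>

section \<open>Multilinear maps on subspaces\<close>

lemma subspace_closed:
  assumes "vector_space s" "module.subspace s S"
  shows "0 \<in> S"
    and "\<And>x y. x \<in> S \<Longrightarrow> y \<in> S \<Longrightarrow> x + y \<in> S"
    and "\<And>x. x \<in> S \<Longrightarrow> - x \<in> S"
    and "\<And>x y. x \<in> S \<Longrightarrow> y \<in> S \<Longrightarrow> x - y \<in> S"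
    and "\<And>c x. x \<in> S \<Longrightarrow> s c x \<in> S"
proof -
  interpret vector_space s by fact
  show "0 \<in> S"
    and "\<And>x y. x \<in> S \<Longrightarrow> y \<in> S \<Longrightarrow> x + y \<in> S"
    and "\<And>x. x \<in> S \<Longrightarrow> - x \<in> S"
    and "\<And>x y. x \<in> S \<Longrightarrow> y \<in> S \<Longrightarrow> x - y \<in> S"
    and "\<And>c x. x \<in> S \<Longrightarrow> s c x \<in> S"
    using assms(2) by (simp_all add: subspace_0 subspace_add subspace_neg subspace_diff subspace_scale)
qed

lemma scale_distrib:
  assumes "vector_space s"
  shows "s c (x + y) = s c x + s c y" "s c (x - y) = s c x - s c y" "s c (- x) = - s c x"
    "s c 0 = 0"
proof -
  interpret vector_space s by fact
  show "s c (x + y) = s c x + s c y" "s c (x - y) = s c x - s c y" "s c (- x) = - s c x"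
    "s c 0 = 0"
    by (simp_all add: scale_right_distrib scale_right_diff_distrib)
qed

lemma linear_onI:
  assumes "\<And>x. x \<in> S \<Longrightarrow> f x \<in> T"
    and "\<And>x y. x \<in> S \<Longrightarrow> y \<in> S \<Longrightarrow> f (x + y) = f x + f y"
    and "\<And>c x. x \<in> S \<Longrightarrow> f (s c x) = t c (f x)"
  shows "linear_on s t S T f"
  using assms by (auto simp: linear_on_def)

lemma linear_onD:
  assumes "linear_on s t S T f" and S: "vector_space s" "module.subspace s S"
  shows "\<And>x. x \<in> S \<Longrightarrow> f x \<in> T"
    and "\<And>x y. x \<in> S \<Longrightarrow> y \<in> S \<Longrightarrow> f (x + y) = f x + f y"
    and "\<And>c x. x \<in> S \<Longrightarrow> f (s c x) = t c (f x)"
    and "f 0 = 0"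
    and "\<And>x. x \<in> S \<Longrightarrow> f (- x) = - f x"
    and "\<And>x y. x \<in> S \<Longrightarrow> y \<in> S \<Longrightarrow> f (x - y) = f x - f y"
proof -
  note cl = subspace_closed[OF S]
  show "\<And>x. x \<in> S \<Longrightarrow> f x \<in> T"
    and add: "\<And>x y. x \<in> S \<Longrightarrow> y \<in> S \<Longrightarrow> f (x + y) = f x + f y"
    and "\<And>c x. x \<in> S \<Longrightarrow> f (s c x) = t c (f x)"
    using assms(1) by (auto simp: linear_on_def)
  show zero: "f 0 = 0" using add[of 0 0] cl by simp
  show minus: "f (- x) = - f x" if "x \<in> S" for x
    using add[of x "- x"] that cl zero by (simp add: eq_neg_iff_add_eq_0 add.commute)
  show "f (x - y) = f x - f y" if "x \<in> S" "y \<in> S" for x y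
    using add[of x "- y"] minus[of y] that cl by simp
qed

lemma bilinear_onI:
  assumes "\<And>x y. x \<in> S \<Longrightarrow> y \<in> T \<Longrightarrow> f x y \<in> R"
    and "\<And>x x' y. x \<in> S \<Longrightarrow> x' \<in> S \<Longrightarrow> y \<in> T \<Longrightarrow> f (x + x') y = f x y + f x' y"
    and "\<And>x y y'. x \<in> S \<Longrightarrow> y \<in> T \<Longrightarrow> y' \<in> T \<Longrightarrow> f x (y + y') = f x y + f x y'"
    and "\<And>c x y. x \<in> S \<Longrightarrow> y \<in> T \<Longrightarrow> f (s c x) y = r c (f x y)"
    and "\<And>c x y. x \<in> S \<Longrightarrow> y \<in> T \<Longrightarrow> f x (t c y) = r c (f x y)"
  shows "bilinear_on s t r S T R f"
  using assms by (auto simp: bilinear_on_def linear_on_def)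

lemma bilinear_onD:
  assumes "bilinear_on s t r S T R f"
    and S: "vector_space s" "module.subspace s S" and T: "vector_space t" "module.subspace t T"
  shows "\<And>x y. x \<in> S \<Longrightarrow> y \<in> T \<Longrightarrow> f x y \<in> R"
    and "\<And>x x' y. x \<in> S \<Longrightarrow> x' \<in> S \<Longrightarrow> y \<in> T \<Longrightarrow> f (x + x') y = f x y + f x' y"
    and "\<And>x y y'. x \<in> S \<Longrightarrow> y \<in> T \<Longrightarrow> y' \<in> T \<Longrightarrow> f x (y + y') = f x y + f x y'"
    and "\<And>c x y. x \<in> S \<Longrightarrow> y \<in> T \<Longrightarrow> f (s c x) y = r c (f x y)"
    and "\<And>c x y. x \<in> S \<Longrightarrow> y \<in> T \<Longrightarrow> f x (t c y) = r c (f x y)"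
    and "\<And>y. y \<in> T \<Longrightarrow> f 0 y = 0"
    and "\<And>x. x \<in> S \<Longrightarrow> f x 0 = 0"
    and "\<And>x x' y. x \<in> S \<Longrightarrow> x' \<in> S \<Longrightarrow> y \<in> T \<Longrightarrow> f (x - x') y = f x y - f x' y"
    and "\<And>x y y'. x \<in> S \<Longrightarrow> y \<in> T \<Longrightarrow> y' \<in> T \<Longrightarrow> f x (y - y') = f x y - f x y'"
proof -
  have l: "linear_on s r S R (\<lambda>x. f x y)" if "y \<in> T" for y
    using assms(1) that by (simp add: bilinear_on_def)
  have r: "linear_on t r T R (f x)" if "x \<in> S" for x
    using assms(1) that by (simp add: bilinear_on_def)
  note L = linear_onD[OF l S] and R = linear_onD[OF r T]
  show "\<And>x y. x \<in> S \<Longrightarrow> y \<in> T \<Longrightarrow> f x y \<in> R"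
    and "\<And>x x' y. x \<in> S \<Longrightarrow> x' \<in> S \<Longrightarrow> y \<in> T \<Longrightarrow> f (x + x') y = f x y + f x' y"
    and "\<And>x y y'. x \<in> S \<Longrightarrow> y \<in> T \<Longrightarrow> y' \<in> T \<Longrightarrow> f x (y + y') = f x y + f x y'"
    and "\<And>c x y. x \<in> S \<Longrightarrow> y \<in> T \<Longrightarrow> f (s c x) y = r c (f x y)"
    and "\<And>c x y. x \<in> S \<Longrightarrow> y \<in> T \<Longrightarrow> f x (t c y) = r c (f x y)"
    and "\<And>y. y \<in> T \<Longrightarrow> f 0 y = 0"
    and "\<And>x. x \<in> S \<Longrightarrow> f x 0 = 0"
    and "\<And>x x' y. x \<in> S \<Longrightarrow> x' \<in> S \<Longrightarrow> y \<in> T \<Longrightarrow> f (x - x') y = f x y - f x' y"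
    and "\<And>x y y'. x \<in> S \<Longrightarrow> y \<in> T \<Longrightarrow> y' \<in> T \<Longrightarrow> f x (y - y') = f x y - f x y'"
    by (assumption | rule L R)+
qed

lemma trilinear_onI:
  assumes "\<And>x y z. x \<in> S \<Longrightarrow> y \<in> T \<Longrightarrow> z \<in> R \<Longrightarrow> f x y z \<in> Q"
    and "\<And>x x' y z. x \<in> S \<Longrightarrow> x' \<in> S \<Longrightarrow> y \<in> T \<Longrightarrow> z \<in> R \<Longrightarrow> f (x + x') y z = f x y z + f x' y z"
    and "\<And>x y y' z. x \<in> S \<Longrightarrow> y \<in> T \<Longrightarrow> y' \<in> T \<Longrightarrow> z \<in> R \<Longrightarrow> f x (y + y') z = f x y z + f x y' z"
    and "\<And>x y z z'. x \<in> S \<Longrightarrow> y \<in> T \<Longrightarrow> z \<in> R \<Longrightarrow> z' \<in> R \<Longrightarrow> f x y (z + z') = f x y z + f x y z'"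
    and "\<And>c x y z. x \<in> S \<Longrightarrow> y \<in> T \<Longrightarrow> z \<in> R \<Longrightarrow> f (s c x) y z = q c (f x y z)"
    and "\<And>c x y z. x \<in> S \<Longrightarrow> y \<in> T \<Longrightarrow> z \<in> R \<Longrightarrow> f x (t c y) z = q c (f x y z)"
    and "\<And>c x y z. x \<in> S \<Longrightarrow> y \<in> T \<Longrightarrow> z \<in> R \<Longrightarrow> f x y (r c z) = q c (f x y z)"
  shows "trilinear_on s t r q S T R Q f"
  using assms by (auto simp: trilinear_on_def bilinear_on_def linear_on_def)

lemma trilinear_onD:
  assumes "trilinear_on s t r q S T R Q f"
    and S: "vector_space s" "module.subspace s S" and T: "vector_space t" "module.subspace t T"
    and R: "vector_space r" "module.subspace r R"
  shows "\<And>x y z. x \<in> S \<Longrightarrow> y \<in> T \<Longrightarrow> z \<in> R \<Longrightarrow> f x y z \<in> Q"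
    and "\<And>x x' y z. x \<in> S \<Longrightarrow> x' \<in> S \<Longrightarrow> y \<in> T \<Longrightarrow> z \<in> R \<Longrightarrow> f (x + x') y z = f x y z + f x' y z"
    and "\<And>x y y' z. x \<in> S \<Longrightarrow> y \<in> T \<Longrightarrow> y' \<in> T \<Longrightarrow> z \<in> R \<Longrightarrow> f x (y + y') z = f x y z + f x y' z"
    and "\<And>x y z z'. x \<in> S \<Longrightarrow> y \<in> T \<Longrightarrow> z \<in> R \<Longrightarrow> z' \<in> R \<Longrightarrow> f x y (z + z') = f x y z + f x y z'"
    and "\<And>c x y z. x \<in> S \<Longrightarrow> y \<in> T \<Longrightarrow> z \<in> R \<Longrightarrow> f (s c x) y z = q c (f x y z)"
    and "\<And>c x y z. x \<in> S \<Longrightarrow> y \<in> T \<Longrightarrow> z \<in> R \<Longrightarrow> f x (t c y) z = q c (f x y z)"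
    and "\<And>c x y z. x \<in> S \<Longrightarrow> y \<in> T \<Longrightarrow> z \<in> R \<Longrightarrow> f x y (r c z) = q c (f x y z)"
    and "\<And>y z. y \<in> T \<Longrightarrow> z \<in> R \<Longrightarrow> f 0 y z = 0"
    and "\<And>x z. x \<in> S \<Longrightarrow> z \<in> R \<Longrightarrow> f x 0 z = 0"
    and "\<And>x y. x \<in> S \<Longrightarrow> y \<in> T \<Longrightarrow> f x y 0 = 0"
    and "\<And>x x' y z. x \<in> S \<Longrightarrow> x' \<in> S \<Longrightarrow> y \<in> T \<Longrightarrow> z \<in> R \<Longrightarrow> f (x - x') y z = f x y z - f x' y z"
    and "\<And>x y y' z. x \<in> S \<Longrightarrow> y \<in> T \<Longrightarrow> y' \<in> T \<Longrightarrow> z \<in> R \<Longrightarrow> f x (y - y') z = f x y z - f x y' z"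
    and "\<And>x y z z'. x \<in> S \<Longrightarrow> y \<in> T \<Longrightarrow> z \<in> R \<Longrightarrow> z' \<in> R \<Longrightarrow> f x y (z - z') = f x y z - f x y z'"
proof -
  have l: "linear_on s q S Q (\<lambda>x. f x y z)" if "y \<in> T" "z \<in> R" for y z
    using assms(1) that by (simp add: trilinear_on_def)
  have b: "bilinear_on t r q T R Q (f x)" if "x \<in> S" for x
    using assms(1) that by (simp add: trilinear_on_def)
  note L = linear_onD[OF l S] and B = bilinear_onD[OF b T R]
  show "\<And>x y z. x \<in> S \<Longrightarrow> y \<in> T \<Longrightarrow> z \<in> R \<Longrightarrow> f x y z \<in> Q"
    and "\<And>x x' y z. x \<in> S \<Longrightarrow> x' \<in> S \<Longrightarrow> y \<in> T \<Longrightarrow> z \<in> R \<Longrightarrow> f (x + x') y z = f x y z + f x' y z"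
    and "\<And>x y y' z. x \<in> S \<Longrightarrow> y \<in> T \<Longrightarrow> y' \<in> T \<Longrightarrow> z \<in> R \<Longrightarrow> f x (y + y') z = f x y z + f x y' z"
    and "\<And>x y z z'. x \<in> S \<Longrightarrow> y \<in> T \<Longrightarrow> z \<in> R \<Longrightarrow> z' \<in> R \<Longrightarrow> f x y (z + z') = f x y z + f x y z'"
    and "\<And>c x y z. x \<in> S \<Longrightarrow> y \<in> T \<Longrightarrow> z \<in> R \<Longrightarrow> f (s c x) y z = q c (f x y z)"
    and "\<And>c x y z. x \<in> S \<Longrightarrow> y \<in> T \<Longrightarrow> z \<in> R \<Longrightarrow> f x (t c y) z = q c (f x y z)"
    and "\<And>c x y z. x \<in> S \<Longrightarrow> y \<in> T \<Longrightarrow> z \<in> R \<Longrightarrow> f x y (r c z) = q c (f x y z)"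
    and "\<And>y z. y \<in> T \<Longrightarrow> z \<in> R \<Longrightarrow> f 0 y z = 0"
    and "\<And>x z. x \<in> S \<Longrightarrow> z \<in> R \<Longrightarrow> f x 0 z = 0"
    and "\<And>x y. x \<in> S \<Longrightarrow> y \<in> T \<Longrightarrow> f x y 0 = 0"
    and "\<And>x x' y z. x \<in> S \<Longrightarrow> x' \<in> S \<Longrightarrow> y \<in> T \<Longrightarrow> z \<in> R \<Longrightarrow> f (x - x') y z = f x y z - f x' y z"
    and "\<And>x y y' z. x \<in> S \<Longrightarrow> y \<in> T \<Longrightarrow> y' \<in> T \<Longrightarrow> z \<in> R \<Longrightarrow> f x (y - y') z = f x y z - f x y' z"
    and "\<And>x y z z'. x \<in> S \<Longrightarrow> y \<in> T \<Longrightarrow> z \<in> R \<Longrightarrow> z' \<in> R \<Longrightarrow> f x y (z - z') = f x y z - f x y z'"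
    by (assumption | rule L B)+
qed

section \<open>Rewrite rules for complexes, algebras and representations\<close>

context two_term_complex
begin

lemmas vs1 = vector_space1 subspace1
lemmas vs0 = vector_space0 subspace0
lemmas space1_closed [simp] = subspace_closed[OF vs1]
lemmas space0_closed [simp] = subspace_closed[OF vs0]
lemmas scale1_distrib [simp] = scale_distrib[OF vector_space1]
lemmas scale0_distrib [simp] = scale_distrib[OF vector_space0]
lemmas bdry_simps [simp] = linear_onD[OF bdry_linear vs1]

end

context assoc2_algebra
begin

lemmas mul00_simps [simp] = bilinear_onD[OF mul00_bilinear vs0 vs0]
lemmas mul01_simps [simp] = bilinear_onD[OF mul01_bilinear vs0 vs1]
lemmas mul10_simps [simp] = bilinear_onD[OF mul10_bilinear vs1 vs0]
lemmas l3_simps [simp] = trilinear_onD[OF l3_trilinear vs0 vs0 vs0]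

lemma l3_pentagon:
  "\<lbrakk>x \<in> space0 A; y \<in> space0 A; z \<in> space0 A; t \<in> space0 A\<rbrakk> \<Longrightarrow>
    mul01 A x (l3 A y z t) = l3 A (mul00 A x y) z t - l3 A x (mul00 A y z) t
      + l3 A x y (mul00 A z t) - mul10 A (l3 A x y z) t"
  using ax_f[of x y z t] by (simp add: algebra_simps)

text \<open>
  As rewrite rules, the axioms move \<open>d\<close> inside products (and from left to right factors), and
  express \<open>d l\<^sub>3\<close> and the values of \<open>l\<^sub>3\<close> on boundaries by products; the pentagon identity is
  solved for the left product with \<open>l\<^sub>3\<close>.  Together with the analogous
  rules for representations and cocycles, this reduces the axioms of a twisted sum to rewriting.
\<close>

lemmas axioms_simps = ax_a ax_b ax_c ax_d ax_e1 ax_e2 ax_e3 l3_pentagon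

end

context alg_representation
begin

lemmas act_simps [simp] =
  bilinear_onD[OF lact00_bilinear A.vs0 V.vs0]
  bilinear_onD[OF lact01_bilinear A.vs0 V.vs1]
  bilinear_onD[OF lact10_bilinear A.vs1 V.vs0]
  bilinear_onD[OF ract00_bilinear V.vs0 A.vs0]
  bilinear_onD[OF ract10_bilinear V.vs1 A.vs0]
  bilinear_onD[OF ract01_bilinear V.vs0 A.vs1]
  trilinear_onD[OF br_aav_trilinear A.vs0 A.vs0 V.vs0]
  trilinear_onD[OF br_ava_trilinear A.vs0 V.vs0 A.vs0]
  trilinear_onD[OF br_vaa_trilinear V.vs0 A.vs0 A.vs0]

lemma pentagon_rewrites:
  assumes "x \<in> space0 A" "y \<in> space0 A" "z \<in> space0 A" "u \<in> space0 V"
  shows "lact01 V x (br_vaa V u y z) = br_vaa V (lact00 V x u) y z - br_ava V x (ract00 V u y) z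
      + br_ava V x u (mul00 A y z) - ract10 V (br_ava V x u y) z"
    and "lact01 V x (br_ava V y u z) = br_ava V (mul00 A x y) u z - br_ava V x (lact00 V y u) z
      + br_aav V x y (ract00 V u z) - ract10 V (br_aav V x y u) z"
    and "lact01 V x (br_aav V y z u) = br_aav V (mul00 A x y) z u - br_aav V x (mul00 A y z) u
      + br_aav V x y (lact00 V z u) - lact10 V (l3 A x y z) u"
    and "ract10 V (br_vaa V u x y) z = br_vaa V (ract00 V u x) y z - br_vaa V u (mul00 A x y) z
      + br_vaa V u x (mul00 A y z) - ract01 V u (l3 A x y z)"
  using pentagon_avaa[of x y z u] pentagon_aava[of x y z u] pentagon_aaav[of x y z u]
    pentagon_vaaa[of x y z u] assms by (simp_all add: algebra_simps)

text \<open>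
  The axioms of a representation as rewrite rules, oriented like those of \<open>A\<close>.  The last four
  remove an action on a bracket.
\<close>

lemmas rep_simps = chain_lact01 chain_lact10 chain_lact11 chain_ract10 chain_ract01 chain_ract11
  assoc_aav0[symmetric] assoc_aav1[symmetric] assoc_aav2[symmetric] assoc_aav3[symmetric]
  assoc_ava0[symmetric] assoc_ava1[symmetric] assoc_ava2[symmetric] assoc_ava3[symmetric]
  assoc_vaa0[symmetric] assoc_vaa1[symmetric] assoc_vaa2[symmetric] assoc_vaa3[symmetric]
  pentagon_rewrites

end

context two_cocycle
begin

lemma cocycle_rewrites:
  "\<lbrakk>x \<in> space0 A; a \<in> space1 A\<rbrakk> \<Longrightarrow>
    bdry V (mu c x a) = lact00 V x (psi c a) - psi c (mul01 A x a) + omega c x (bdry A a)"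
  "\<lbrakk>x \<in> space0 A; a \<in> space1 A\<rbrakk> \<Longrightarrow>
    bdry V (nu c a x) = ract00 V (psi c a) x - psi c (mul10 A a x) + omega c (bdry A a) x"
  "\<lbrakk>a \<in> space1 A; b \<in> space1 A\<rbrakk> \<Longrightarrow>
    mu c (bdry A a) b = lact10 V a (psi c b) + nu c a (bdry A b) - ract01 V (psi c a) b"
  "\<lbrakk>x \<in> space0 A; y \<in> space0 A; z \<in> space0 A\<rbrakk> \<Longrightarrow>
    bdry V (theta c x y z) = ract00 V (omega c x y) z - lact00 V x (omega c y z)
      + omega c (mul00 A x y) z - omega c x (mul00 A y z) - psi c (l3 A x y z)"
  "\<lbrakk>x \<in> space0 A; y \<in> space0 A; a \<in> space1 A\<rbrakk> \<Longrightarrow>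
    theta c x y (bdry A a) = ract01 V (omega c x y) a - lact01 V x (mu c y a)
      + mu c (mul00 A x y) a - mu c x (mul01 A y a) - br_aav V x y (psi c a)"
  "\<lbrakk>x \<in> space0 A; y \<in> space0 A; a \<in> space1 A\<rbrakk> \<Longrightarrow>
    theta c x (bdry A a) y = ract10 V (mu c x a) y - lact01 V x (nu c a y)
      + nu c (mul01 A x a) y - mu c x (mul10 A a y) - br_ava V x (psi c a) y"
  "\<lbrakk>x \<in> space0 A; y \<in> space0 A; a \<in> space1 A\<rbrakk> \<Longrightarrow>
    theta c (bdry A a) x y = ract10 V (nu c a x) y - lact10 V a (omega c x y)
      + nu c (mul10 A a x) y - nu c a (mul00 A x y) - br_vaa V (psi c a) x y"
  "\<lbrakk>x \<in> space0 A; y \<in> space0 A; z \<in> space0 A; t \<in> space0 A\<rbrakk> \<Longrightarrow>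
    lact01 V x (theta c y z t) = theta c (mul00 A x y) z t - theta c x (mul00 A y z) t
      + theta c x y (mul00 A z t) - ract10 V (theta c x y z) t
      - mu c x (l3 A y z t) - nu c (l3 A x y z) t
      + br_aav V x y (omega c z t) + br_vaa V (omega c x y) z t - br_ava V x (omega c y z) t"
  subgoal using cocycle1[of x a] by (simp add: algebra_simps)
  subgoal using cocycle2[of x a] by (simp add: algebra_simps)
  subgoal using cocycle3[of a b] by (simp add: algebra_simps)
  subgoal using cocycle4[of x y z] by (simp add: algebra_simps)
  subgoal using cocycle5[of x y a] by (simp add: algebra_simps)
  subgoal using cocycle6[of x y a] by (simp add: algebra_simps)
  subgoal using cocycle7[of x y a] by (simp add: algebra_simps)
  subgoal using cocycle8[of x y z t] by (simp add: algebra_simps)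
  done

end

section \<open>Twisted direct sums\<close>

text \<open>
  The structure \<open>E\<close> is \<open>A \<oplus> V\<close> twisted by the cochain \<open>c\<close>: the maps \<open>J0\<close> and \<open>J1\<close> are linear
  bijections from \<open>A\<^sub>i \<oplus> V\<^sub>i\<close> to \<open>E\<^sub>i\<close>, written as functions of two arguments, and the structure
  maps of \<open>E\<close> are the semidirect ones plus \<open>c\<close>.  Neither is \<open>c\<close> assumed to be a cocycle nor \<open>E\<close> to
  satisfy the axioms of an associative 2-algebra.
\<close>

locale twisted_sum = alg_representation A V + E: two_term_complex E
  for A :: "('k::field, 'a1::ab_group_add, 'a0::ab_group_add) two_alg"
    and V :: "('k, 'v1::ab_group_add, 'v0::ab_group_add, 'a1, 'a0) rep"
    and E :: "('k, 'e1::ab_group_add, 'e0::ab_group_add) two_alg" +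
  fixes J0 :: "'a0 \<Rightarrow> 'v0 \<Rightarrow> 'e0" and J1 :: "'a1 \<Rightarrow> 'v1 \<Rightarrow> 'e1"
    and c :: "('a1, 'a0, 'v1, 'v0) cochain"
  assumes J0_image: "space0 E = case_prod J0 ` (space0 A \<times> space0 V)"
    and J1_image: "space1 E = case_prod J1 ` (space1 A \<times> space1 V)"
    and J0_inject: "\<lbrakk>x \<in> space0 A; u \<in> space0 V; y \<in> space0 A; v \<in> space0 V\<rbrakk> \<Longrightarrow>
      J0 x u = J0 y v \<longleftrightarrow> x = y \<and> u = v"
    and J1_inject: "\<lbrakk>a \<in> space1 A; m \<in> space1 V; b \<in> space1 A; n \<in> space1 V\<rbrakk> \<Longrightarrow>
      J1 a m = J1 b n \<longleftrightarrow> a = b \<and> m = n"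
    and J0_add: "\<lbrakk>x \<in> space0 A; u \<in> space0 V; y \<in> space0 A; v \<in> space0 V\<rbrakk> \<Longrightarrow>
      J0 x u + J0 y v = J0 (x + y) (u + v)"
    and J1_add: "\<lbrakk>a \<in> space1 A; m \<in> space1 V; b \<in> space1 A; n \<in> space1 V\<rbrakk> \<Longrightarrow>
      J1 a m + J1 b n = J1 (a + b) (m + n)"
    and J0_scale: "\<lbrakk>x \<in> space0 A; u \<in> space0 V\<rbrakk> \<Longrightarrow>
      scale0 E k (J0 x u) = J0 (scale0 A k x) (scale0 V k u)"
    and J1_scale: "\<lbrakk>a \<in> space1 A; m \<in> space1 V\<rbrakk> \<Longrightarrow>
      scale1 E k (J1 a m) = J1 (scale1 A k a) (scale1 V k m)"
    and psi_linear: "linear_on (scale1 A) (scale0 V) (space1 A) (space0 V) (psi c)"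
    and omega_bilinear: "bilinear_on (scale0 A) (scale0 A) (scale0 V)
      (space0 A) (space0 A) (space0 V) (omega c)"
    and mu_bilinear: "bilinear_on (scale0 A) (scale1 A) (scale1 V)
      (space0 A) (space1 A) (space1 V) (mu c)"
    and nu_bilinear: "bilinear_on (scale1 A) (scale0 A) (scale1 V)
      (space1 A) (space0 A) (space1 V) (nu c)"
    and theta_trilinear: "trilinear_on (scale0 A) (scale0 A) (scale0 A) (scale1 V)
      (space0 A) (space0 A) (space0 A) (space1 V) (theta c)"
    and bdry_J: "\<lbrakk>a \<in> space1 A; m \<in> space1 V\<rbrakk> \<Longrightarrow>
      bdry E (J1 a m) = J0 (bdry A a) (bdry V m + psi c a)"
    and mul00_J: "\<lbrakk>x \<in> space0 A; u \<in> space0 V; y \<in> space0 A; v \<in> space0 V\<rbrakk> \<Longrightarrow>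
      mul00 E (J0 x u) (J0 y v)
        = J0 (mul00 A x y) (lact00 V x v + ract00 V u y + omega c x y)"
    and mul01_J: "\<lbrakk>x \<in> space0 A; u \<in> space0 V; a \<in> space1 A; m \<in> space1 V\<rbrakk> \<Longrightarrow>
      mul01 E (J0 x u) (J1 a m)
        = J1 (mul01 A x a) (lact01 V x m + ract01 V u a + mu c x a)"
    and mul10_J: "\<lbrakk>x \<in> space0 A; u \<in> space0 V; a \<in> space1 A; m \<in> space1 V\<rbrakk> \<Longrightarrow>
      mul10 E (J1 a m) (J0 x u)
        = J1 (mul10 A a x) (lact10 V a u + ract10 V m x + nu c a x)"
    and l3_J: "\<lbrakk>x \<in> space0 A; u \<in> space0 V; y \<in> space0 A; v \<in> space0 V;
        z \<in> space0 A; w \<in> space0 V\<rbrakk> \<Longrightarrow>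
      l3 E (J0 x u) (J0 y v) (J0 z w)
        = J1 (l3 A x y z) (br_aav V x y w + br_ava V x v z + br_vaa V u y z + theta c x y z)"
begin

lemmas cochain_simps [simp] =
  linear_onD[OF psi_linear A.vs1]
  bilinear_onD[OF omega_bilinear A.vs0 A.vs0]
  bilinear_onD[OF mu_bilinear A.vs0 A.vs1]
  bilinear_onD[OF nu_bilinear A.vs1 A.vs0]
  trilinear_onD[OF theta_trilinear A.vs0 A.vs0 A.vs0]

declare J0_add [simp] J1_add [simp] J0_scale [simp] J1_scale [simp] J0_inject [simp]
  J1_inject [simp] bdry_J [simp] mul00_J [simp] mul01_J [simp] mul10_J [simp] l3_J [simp]

lemma J0_in [simp]: "x \<in> space0 A \<Longrightarrow> u \<in> space0 V \<Longrightarrow> J0 x u \<in> space0 E"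
  and J1_in [simp]: "a \<in> space1 A \<Longrightarrow> m \<in> space1 V \<Longrightarrow> J1 a m \<in> space1 E"
  by (auto simp: J0_image J1_image)

lemma E0_cases:
  assumes "\<alpha> \<in> space0 E"
  obtains x u where "x \<in> space0 A" "u \<in> space0 V" "\<alpha> = J0 x u"
  using assms by (auto simp: J0_image)

lemma E1_cases:
  assumes "\<beta> \<in> space1 E"
  obtains a m where "a \<in> space1 A" "m \<in> space1 V" "\<beta> = J1 a m"
  using assms by (auto simp: J1_image)

lemma J0_zero [simp]: "J0 0 0 = 0"
  using J0_add[of 0 0 0 0] by (simp del: J0_add)

lemma J1_zero [simp]: "J1 0 0 = 0"
  using J1_add[of 0 0 0 0] by (simp del: J1_add)

lemma J0_diff [simp]: "\<lbrakk>x \<in> space0 A; u \<in> space0 V; y \<in> space0 A; v \<in> space0 V\<rbrakk> \<Longrightarrow>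
    J0 x u - J0 y v = J0 (x - y) (u - v)"
  by (simp add: diff_eq_eq)

lemma J1_diff [simp]: "\<lbrakk>a \<in> space1 A; m \<in> space1 V; b \<in> space1 A; n \<in> space1 V\<rbrakk> \<Longrightarrow>
    J1 a m - J1 b n = J1 (a - b) (m - n)"
  by (simp add: diff_eq_eq)

lemma J1_minus [simp]: "\<lbrakk>a \<in> space1 A; m \<in> space1 V\<rbrakk> \<Longrightarrow> - J1 a m = J1 (- a) (- m)"
  using J1_diff[of 0 0 a m] by simp

lemma J0_eq_0 [simp]: "\<lbrakk>x \<in> space0 A; u \<in> space0 V\<rbrakk> \<Longrightarrow> J0 x u = 0 \<longleftrightarrow> x = 0 \<and> u = 0"
  using J0_inject[of x u 0 0] by simp

lemma J1_eq_0 [simp]: "\<lbrakk>a \<in> space1 A; m \<in> space1 V\<rbrakk> \<Longrightarrow> J1 a m = 0 \<longleftrightarrow> a = 0 \<and> m = 0"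
  using J1_inject[of a m 0 0] by simp

lemma algebra_if_cocycle:
  assumes "two_cocycle A V c"
  shows "assoc2_algebra E"
proof -
  interpret c: two_cocycle A V c by fact
  note rules = A.axioms_simps rep_simps c.cocycle_rewrites
  show ?thesis
  proof
    show "bilinear_on (scale0 E) (scale0 E) (scale0 E)
      (space0 E) (space0 E) (space0 E) (mul00 E)"
      by (rule bilinear_onI; elim E0_cases; simp add: ac_simps)
    show "bilinear_on (scale0 E) (scale1 E) (scale1 E)
      (space0 E) (space1 E) (space1 E) (mul01 E)"
      by (rule bilinear_onI; elim E0_cases E1_cases; simp add: ac_simps)
    show "bilinear_on (scale1 E) (scale0 E) (scale1 E)
      (space1 E) (space0 E) (space1 E) (mul10 E)"
      by (rule bilinear_onI; elim E0_cases E1_cases; simp add: ac_simps)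
    show "trilinear_on (scale0 E) (scale0 E) (scale0 E) (scale1 E)
      (space0 E) (space0 E) (space0 E) (space1 E) (l3 E)"
      by (rule trilinear_onI; elim E0_cases; simp add: ac_simps)
  next
    fix \<alpha> \<beta> assume "\<alpha> \<in> space0 E" "\<beta> \<in> space1 E"
    then show "bdry E (mul01 E \<alpha> \<beta>) = mul00 E \<alpha> (bdry E \<beta>)"
      and "bdry E (mul10 E \<beta> \<alpha>) = mul00 E (bdry E \<beta>) \<alpha>"
      by (elim E0_cases E1_cases; simp add: rules algebra_simps)+
  next
    fix \<alpha> \<beta> assume "\<alpha> \<in> space1 E" "\<beta> \<in> space1 E"
    then show "mul01 E (bdry E \<alpha>) \<beta> = mul10 E \<alpha> (bdry E \<beta>)"
      by (elim E0_cases E1_cases; simp add: rules algebra_simps)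
  next
    fix \<alpha> \<beta> \<gamma> assume "\<alpha> \<in> space0 E" "\<beta> \<in> space0 E" "\<gamma> \<in> space0 E"
    then show "bdry E (l3 E \<alpha> \<beta> \<gamma>) = mul00 E (mul00 E \<alpha> \<beta>) \<gamma> - mul00 E \<alpha> (mul00 E \<beta> \<gamma>)"
      by (elim E0_cases E1_cases; simp add: rules algebra_simps)
  next
    fix \<alpha> \<beta> \<gamma> assume "\<alpha> \<in> space0 E" "\<beta> \<in> space0 E" "\<gamma> \<in> space1 E"
    then show "l3 E \<alpha> \<beta> (bdry E \<gamma>) = mul01 E (mul00 E \<alpha> \<beta>) \<gamma> - mul01 E \<alpha> (mul01 E \<beta> \<gamma>)"
      and "l3 E \<alpha> (bdry E \<gamma>) \<beta> = mul10 E (mul01 E \<alpha> \<gamma>) \<beta> - mul01 E \<alpha> (mul10 E \<gamma> \<beta>)"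
      and "l3 E (bdry E \<gamma>) \<alpha> \<beta> = mul10 E (mul10 E \<gamma> \<alpha>) \<beta> - mul10 E \<gamma> (mul00 E \<alpha> \<beta>)"
      by (elim E0_cases E1_cases; simp add: rules algebra_simps)+
  next
    fix \<alpha> \<beta> \<gamma> \<delta>
    assume "\<alpha> \<in> space0 E" "\<beta> \<in> space0 E" "\<gamma> \<in> space0 E" "\<delta> \<in> space0 E"
    then show "mul01 E \<alpha> (l3 E \<beta> \<gamma> \<delta>) + mul10 E (l3 E \<alpha> \<beta> \<gamma>) \<delta>
        = l3 E (mul00 E \<alpha> \<beta>) \<gamma> \<delta> - l3 E \<alpha> (mul00 E \<beta> \<gamma>) \<delta> + l3 E \<alpha> \<beta> (mul00 E \<gamma> \<delta>)"
      by (elim E0_cases E1_cases; simp add: rules algebra_simps)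
  qed
qed

text \<open>Each cocycle condition is an axiom of \<open>E\<close> evaluated on elements \<open>J0 x 0\<close>, \<open>J1 a 0\<close>.\<close>

lemma cocycle_if_algebra:
  assumes "assoc2_algebra E"
  shows "two_cocycle A V c"
proof -
  interpret EA: assoc2_algebra E by fact
  show ?thesis
  proof
    fix x a assume xa: "x \<in> space0 A" "a \<in> space1 A"
    show "lact00 V x (psi c a) - psi c (mul01 A x a) + omega c x (bdry A a) - bdry V (mu c x a) = 0"
      using EA.ax_a[of "J0 x 0" "J1 a 0"] xa by (simp add: algebra_simps)
    show "ract00 V (psi c a) x - psi c (mul10 A a x) + omega c (bdry A a) x - bdry V (nu c a x) = 0"
      using EA.ax_b[of "J0 x 0" "J1 a 0"] xa by (simp add: algebra_simps)
  next
    fix a b assume ab: "a \<in> space1 A" "b \<in> space1 A"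
    then show "lact10 V a (psi c b) + nu c a (bdry A b) - ract01 V (psi c a) b - mu c (bdry A a) b = 0"
      using EA.ax_c[of "J1 a 0" "J1 b 0"] by (simp add: algebra_simps)
  next
    fix x y z assume "x \<in> space0 A" "y \<in> space0 A" "z \<in> space0 A"
    then show "ract00 V (omega c x y) z - lact00 V x (omega c y z)
        + omega c (mul00 A x y) z - omega c x (mul00 A y z)
        = bdry V (theta c x y z) + psi c (l3 A x y z)"
      using EA.ax_d[of "J0 x 0" "J0 y 0" "J0 z 0"] by (simp add: algebra_simps)
  next
    fix x y a assume xya: "x \<in> space0 A" "y \<in> space0 A" "a \<in> space1 A"
    show "ract01 V (omega c x y) a - lact01 V x (mu c y a)
        + mu c (mul00 A x y) a - mu c x (mul01 A y a)
        = theta c x y (bdry A a) + br_aav V x y (psi c a)"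
      using EA.ax_e1[of "J0 x 0" "J0 y 0" "J1 a 0"] xya by (simp add: algebra_simps)
    show "ract10 V (mu c x a) y - lact01 V x (nu c a y)
        + nu c (mul01 A x a) y - mu c x (mul10 A a y)
        = theta c x (bdry A a) y + br_ava V x (psi c a) y"
      using EA.ax_e2[of "J0 x 0" "J0 y 0" "J1 a 0"] xya by (simp add: algebra_simps)
    show "ract10 V (nu c a x) y - lact10 V a (omega c x y)
        + nu c (mul10 A a x) y - nu c a (mul00 A x y)
        = theta c (bdry A a) x y + br_vaa V (psi c a) x y"
      using EA.ax_e3[of "J0 x 0" "J0 y 0" "J1 a 0"] xya by (simp add: algebra_simps)
  next
    fix x y z t assume "x \<in> space0 A" "y \<in> space0 A" "z \<in> space0 A" "t \<in> space0 A"
    then show "lact01 V x (theta c y z t) + ract10 V (theta c x y z) t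
        - theta c (mul00 A x y) z t + theta c x (mul00 A y z) t - theta c x y (mul00 A z t)
        = - (mu c x (l3 A y z t) + nu c (l3 A x y z) t
             - br_aav V x y (omega c z t) - br_vaa V (omega c x y) z t
             + br_ava V x (omega c y z) t)"
      using EA.ax_f[of "J0 x 0" "J0 y 0" "J0 z 0" "J0 t 0"] by (simp add: algebra_simps)
  qed (use psi_linear omega_bilinear mu_bilinear nu_bilinear theta_trilinear in auto)
qed

end

section \<open>Extensions in coordinates\<close>

lemma abelian_alg_simps [simp]:
  "scale1 (abelian_alg V) = scale1 V" "scale0 (abelian_alg V) = scale0 V"
  "space1 (abelian_alg V) = space1 V" "space0 (abelian_alg V) = space0 V"
  "bdry (abelian_alg V) = bdry V"
  "mul00 (abelian_alg V) = (\<lambda>_ _. 0)" "mul01 (abelian_alg V) = (\<lambda>_ _. 0)"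
  "mul10 (abelian_alg V) = (\<lambda>_ _. 0)" "l3 (abelian_alg V) = (\<lambda>_ _ _. 0)"
  by (simp_all add: abelian_alg_def)

lemma (in two_term_complex) abelian_alg: "assoc2_algebra (abelian_alg C)"
  using vector_space1 vector_space0 subspace1 subspace0 bdry_linear
  by (intro assoc2_algebra.intro two_term_complex.intro assoc2_algebra_axioms.intro)
    (auto intro!: bilinear_onI trilinear_onI)

text \<open>
  The total space of the extension \<open>E\<close> is \<open>A \<oplus> V\<close> twisted by \<open>c\<close>, with the standard inclusion of
  \<open>V\<close> and projection to \<open>A\<close>, both with vanishing quadratic component.
\<close>

locale extension_coordinates = twisted_sum A V "total E" J0 J1 c
  for A :: "('k::field, 'a1::ab_group_add, 'a0::ab_group_add) two_alg"
    and V :: "('k, 'v1::ab_group_add, 'v0::ab_group_add, 'a1, 'a0) rep"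
    and E :: "('k, 'v1, 'v0, 'e1::ab_group_add, 'e0::ab_group_add, 'a1, 'a0) ext"
    and J0 J1 c +
  assumes incl0 [simp]: "u \<in> space0 V \<Longrightarrow> hom0 (incl E) u = J0 0 u"
    and incl1 [simp]: "m \<in> space1 V \<Longrightarrow> hom1 (incl E) m = J1 0 m"
    and incl2 [simp]: "\<lbrakk>u \<in> space0 V; v \<in> space0 V\<rbrakk> \<Longrightarrow> hom2 (incl E) u v = 0"
    and proj0 [simp]: "\<lbrakk>x \<in> space0 A; u \<in> space0 V\<rbrakk> \<Longrightarrow> hom0 (proj E) (J0 x u) = x"
    and proj1 [simp]: "\<lbrakk>a \<in> space1 A; m \<in> space1 V\<rbrakk> \<Longrightarrow> hom1 (proj E) (J1 a m) = a"
    and proj2 [simp]: "\<lbrakk>\<alpha> \<in> space0 (total E); \<beta> \<in> space0 (total E)\<rbrakk> \<Longrightarrow> hom2 (proj E) \<alpha> \<beta> = 0"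
begin

lemma E0_fibre: "\<alpha> \<in> space0 (total E) \<Longrightarrow> \<exists>u. u \<in> space0 V \<and> \<alpha> = J0 (hom0 (proj E) \<alpha>) u"
  by (elim E0_cases) auto

lemma E1_fibre: "\<beta> \<in> space1 (total E) \<Longrightarrow> \<exists>m. m \<in> space1 V \<and> \<beta> = J1 (hom1 (proj E) \<beta>) m"
  by (elim E1_cases) auto

text \<open>In coordinates, splittings are the graphs of linear maps \<open>A \<rightarrow> V\<close>.\<close>

lemma splitting_iff:
  "splitting A E \<sigma>0 \<sigma>1 \<longleftrightarrow>
    (\<exists>\<delta>0 \<delta>1. linear_on (scale0 A) (scale0 V) (space0 A) (space0 V) \<delta>0 \<and>
      linear_on (scale1 A) (scale1 V) (space1 A) (space1 V) \<delta>1 \<and>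
      (\<forall>x\<in>space0 A. \<sigma>0 x = J0 x (\<delta>0 x)) \<and> (\<forall>a\<in>space1 A. \<sigma>1 a = J1 a (\<delta>1 a)))"
  (is "?L \<longleftrightarrow> ?R")
proof
  assume ?L
  then have s0: "linear_on (scale0 A) (scale0 (total E)) (space0 A) (space0 (total E)) \<sigma>0"
    and s1: "linear_on (scale1 A) (scale1 (total E)) (space1 A) (space1 (total E)) \<sigma>1"
    and p0: "\<And>x. x \<in> space0 A \<Longrightarrow> hom0 (proj E) (\<sigma>0 x) = x"
    and p1: "\<And>a. a \<in> space1 A \<Longrightarrow> hom1 (proj E) (\<sigma>1 a) = a"
    by (auto simp: splitting_def)
  note L0 = linear_onD[OF s0 A.vs0] and L1 = linear_onD[OF s1 A.vs1]
  have "\<exists>u. u \<in> space0 V \<and> \<sigma>0 x = J0 x u" if "x \<in> space0 A" for x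
    using E0_fibre[OF L0(1)[OF that]] p0[OF that] by simp
  then obtain \<delta>0 where d0: "\<And>x. x \<in> space0 A \<Longrightarrow> \<delta>0 x \<in> space0 V"
    and d0': "\<And>x. x \<in> space0 A \<Longrightarrow> \<sigma>0 x = J0 x (\<delta>0 x)"
    by metis
  have "\<exists>m. m \<in> space1 V \<and> \<sigma>1 a = J1 a m" if "a \<in> space1 A" for a
    using E1_fibre[OF L1(1)[OF that]] p1[OF that] by simp
  then obtain \<delta>1 where d1: "\<And>a. a \<in> space1 A \<Longrightarrow> \<delta>1 a \<in> space1 V"
    and d1': "\<And>a. a \<in> space1 A \<Longrightarrow> \<sigma>1 a = J1 a (\<delta>1 a)"
    by metis
  have "linear_on (scale0 A) (scale0 V) (space0 A) (space0 V) \<delta>0"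
    using L0(2,3) by (intro linear_onI) (auto simp: d0 d0')
  moreover have "linear_on (scale1 A) (scale1 V) (space1 A) (space1 V) \<delta>1"
    using L1(2,3) by (intro linear_onI) (auto simp: d1 d1')
  ultimately show ?R
    using d0' d1' by auto
next
  assume ?R
  then obtain \<delta>0 \<delta>1 where l0: "linear_on (scale0 A) (scale0 V) (space0 A) (space0 V) \<delta>0"
    and l1: "linear_on (scale1 A) (scale1 V) (space1 A) (space1 V) \<delta>1"
    and s: "\<And>x. x \<in> space0 A \<Longrightarrow> \<sigma>0 x = J0 x (\<delta>0 x)" "\<And>a. a \<in> space1 A \<Longrightarrow> \<sigma>1 a = J1 a (\<delta>1 a)"
    by auto
  show ?L
    using linear_onD[OF l0 A.vs0] linear_onD[OF l1 A.vs1] unfolding splitting_def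
    by (intro conjI linear_onI ballI) (simp_all add: s)
qed

lemma splitting_zero: "splitting A E (\<lambda>x. J0 x 0) (\<lambda>a. J1 a 0)"
  unfolding splitting_iff
  by (intro exI[of _ "\<lambda>_. 0"] conjI linear_onI) simp_all

text \<open>
  The induced representation does not depend on the splitting: the terms containing \<open>\<delta>\<close> are
  products or brackets with two arguments in \<open>V\<close>, which do not occur in a twisted sum.
\<close>

lemma induces_if_splitting:
  assumes "splitting A E \<sigma>0 \<sigma>1"
  shows "induces A V E \<sigma>0 \<sigma>1"
proof -
  obtain \<delta>0 \<delta>1 where l0: "linear_on (scale0 A) (scale0 V) (space0 A) (space0 V) \<delta>0"
    and l1: "linear_on (scale1 A) (scale1 V) (space1 A) (space1 V) \<delta>1"
    and s: "\<And>x. x \<in> space0 A \<Longrightarrow> \<sigma>0 x = J0 x (\<delta>0 x)" "\<And>a. a \<in> space1 A \<Longrightarrow> \<sigma>1 a = J1 a (\<delta>1 a)"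
    using assms by (auto simp: splitting_iff)
  show ?thesis
    using linear_onD(1)[OF l0 A.vs0] linear_onD(1)[OF l1 A.vs1] by (simp add: induces_def s)
qed

lemma abelian_extension_if_algebra:
  assumes "assoc2_algebra (total E)"
  shows "E \<in> abelian_extensions A V"
proof -
  interpret EA: assoc2_algebra "total E" by fact
  interpret B: assoc2_algebra "abelian_alg V" by (rule V.abelian_alg)
  interpret i: strict_hom "abelian_alg V" "total E" "incl E"
    by unfold_locales (auto intro!: linear_onI bilinear_onI)
  interpret p: strict_hom "total E" A "proj E"
    by unfold_locales (auto intro!: linear_onI bilinear_onI elim!: E0_cases E1_cases)
  have "abelian_extension A V E"
  proof
    show "{u \<in> space0 (abelian_alg V). hom0 (incl E) u = 0} = {0}"
      and "{m \<in> space1 (abelian_alg V). hom1 (incl E) m = 0} = {0}"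
      by auto
    show "hom0 (incl E) ` space0 (abelian_alg V)
        = {\<alpha> \<in> space0 (total E). hom0 (proj E) \<alpha> = 0}"
      and "hom1 (incl E) ` space1 (abelian_alg V)
        = {\<beta> \<in> space1 (total E). hom1 (proj E) \<beta> = 0}"
      by (auto elim!: E0_cases E1_cases)
    show "hom0 (proj E) ` space0 (total E) = space0 A"
    proof (intro equalityI subsetI)
      fix x assume "x \<in> space0 A"
      then show "x \<in> hom0 (proj E) ` space0 (total E)"
        by (intro image_eqI[of _ _ "J0 x 0"]) simp_all
    qed (auto elim!: E0_cases)
    show "hom1 (proj E) ` space1 (total E) = space1 A"
    proof (intro equalityI subsetI)
      fix a assume "a \<in> space1 A"
      then show "a \<in> hom1 (proj E) ` space1 (total E)"
        by (intro image_eqI[of _ _ "J1 a 0"]) simp_all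
    qed (auto elim!: E1_cases)
  qed (auto elim!: E0_cases)
  with splitting_zero induces_if_splitting show ?thesis
    by (auto simp: abelian_extensions_def)
qed

end

section \<open>The cocycle of a splitting\<close>

lemma linear_on_cancel:
  assumes "linear_on s q S Q (\<lambda>x. i (f x))" "linear_on t q T Q i" "inj_on i T"
    "vector_space t" "module.subspace t T" "vector_space s" "module.subspace s S"
    and f: "\<And>x. x \<in> S \<Longrightarrow> f x \<in> T"
  shows "linear_on s t S T f"
proof (rule linear_onI)
  note cl = subspace_closed[OF assms(4,5)] subspace_closed[OF assms(6,7)]
  note I = linear_onD[OF assms(2,4,5)] and F = linear_onD[OF assms(1,6,7)]
  show "f (x + y) = f x + f y" if "x \<in> S" "y \<in> S" for x y
    using that F(2)[of x y] I(2)[of "f x" "f y"]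
    by (intro inj_onD[OF assms(3)]) (simp_all add: cl f)
  show "f (s k x) = t k (f x)" if "x \<in> S" for k x
    using that F(3)[of x k] I(3)[of "f x" k]
    by (intro inj_onD[OF assms(3)]) (simp_all add: cl f)
qed (rule f)

context alg_representation
begin

text \<open>
  The cochain is the defect of the splitting from being a strict homomorphism; it takes values in
  the kernel of the projection, hence in the image of \<open>V\<close>.
\<close>

lemma extension_coordinates_if_induces:
  assumes "abelian_extension A V E" "splitting A E \<sigma>0 \<sigma>1" "induces A V E \<sigma>0 \<sigma>1"
  shows "\<exists>c. extension_cocycle A E \<sigma>0 \<sigma>1 c \<and>
    extension_coordinates A V E (\<lambda>x u. \<sigma>0 x + hom0 (incl E) u) (\<lambda>a m. \<sigma>1 a + hom1 (incl E) m) c"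
proof -
  interpret X: abelian_extension A V E by fact
  let ?E = "total E"
  define i0 i1 where "i0 = hom0 (incl E)" and "i1 = hom1 (incl E)"
  define p0 p1 where "p0 = hom0 (proj E)" and "p1 = hom1 (proj E)"
  note hom_defs = i0_def[symmetric] i1_def[symmetric] p0_def[symmetric] p1_def[symmetric]
  have i0: "linear_on (scale0 V) (scale0 ?E) (space0 V) (space0 ?E) i0"
    and i1: "linear_on (scale1 V) (scale1 ?E) (space1 V) (space1 ?E) i1"
    using X.i.hom0_linear X.i.hom1_linear by (simp_all add: hom_defs)
  have p0: "linear_on (scale0 ?E) (scale0 A) (space0 ?E) (space0 A) p0"
    and p1: "linear_on (scale1 ?E) (scale1 A) (space1 ?E) (space1 A) p1"
    using X.p.hom0_linear X.p.hom1_linear by (simp_all add: hom_defs)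
  have s0: "linear_on (scale0 A) (scale0 ?E) (space0 A) (space0 ?E) \<sigma>0"
    and s1: "linear_on (scale1 A) (scale1 ?E) (space1 A) (space1 ?E) \<sigma>1"
    and ps0 [simp]: "\<And>x. x \<in> space0 A \<Longrightarrow> p0 (\<sigma>0 x) = x"
    and ps1 [simp]: "\<And>a. a \<in> space1 A \<Longrightarrow> p1 (\<sigma>1 a) = a"
    using assms(2) by (auto simp: splitting_def hom_defs)
  note [simp] = linear_onD[OF i0 V.vs0] linear_onD[OF i1 V.vs1]
    linear_onD[OF p0 X.i.B.vs0] linear_onD[OF p1 X.i.B.vs1]
    linear_onD[OF s0 A.vs0] linear_onD[OF s1 A.vs1]
  have im0: "i0 ` space0 V = {\<alpha> \<in> space0 ?E. p0 \<alpha> = 0}"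
    and im1: "i1 ` space1 V = {\<beta> \<in> space1 ?E. p1 \<beta> = 0}"
    using X.exact0 X.exact1 by (simp_all add: hom_defs)
  have i0_eq_0: "u = 0" if "u \<in> space0 V" "i0 u = 0" for u
    using X.ker_incl0 that by (auto simp: hom_defs)
  have i1_eq_0: "m = 0" if "m \<in> space1 V" "i1 m = 0" for m
    using X.ker_incl1 that by (auto simp: hom_defs)
  have inj0: "inj_on i0 (space0 V)"
    by (rule inj_onI) (metis i0_eq_0 V.space0_closed(4) linear_onD(6)[OF i0 V.vs0] eq_iff_diff_eq_0)
  have inj1: "inj_on i1 (space1 V)"
    by (rule inj_onI) (metis i1_eq_0 V.space1_closed(4) linear_onD(6)[OF i1 V.vs1] eq_iff_diff_eq_0)
  have pi0 [simp]: "p0 (i0 u) = 0" if "u \<in> space0 V" for u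
    using im0 that by blast
  have pi1 [simp]: "p1 (i1 m) = 0" if "m \<in> space1 V" for m
    using im1 that by blast
  define k0 k1 where "k0 = inv_into (space0 V) i0" and "k1 = inv_into (space1 V) i1"
  have k0 [simp]: "k0 \<alpha> \<in> space0 V" "i0 (k0 \<alpha>) = \<alpha>" if "\<alpha> \<in> space0 ?E" "p0 \<alpha> = 0" for \<alpha>
    using that im0 by (simp_all add: k0_def inv_into_into f_inv_into_f)
  have k1 [simp]: "k1 \<beta> \<in> space1 V" "i1 (k1 \<beta>) = \<beta>" if "\<beta> \<in> space1 ?E" "p1 \<beta> = 0" for \<beta>
    using that im1 by (simp_all add: k1_def inv_into_into f_inv_into_f)
  have p_hom [simp]:
    "\<And>\<beta>. \<beta> \<in> space1 ?E \<Longrightarrow> p0 (bdry ?E \<beta>) = bdry A (p1 \<beta>)"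
    "\<And>\<alpha> \<beta>. \<alpha> \<in> space0 ?E \<Longrightarrow> \<beta> \<in> space0 ?E \<Longrightarrow> p0 (mul00 ?E \<alpha> \<beta>) = mul00 A (p0 \<alpha>) (p0 \<beta>)"
    "\<And>\<alpha> \<beta>. \<alpha> \<in> space0 ?E \<Longrightarrow> \<beta> \<in> space1 ?E \<Longrightarrow> p1 (mul01 ?E \<alpha> \<beta>) = mul01 A (p0 \<alpha>) (p1 \<beta>)"
    "\<And>\<alpha> \<beta>. \<alpha> \<in> space0 ?E \<Longrightarrow> \<beta> \<in> space1 ?E \<Longrightarrow> p1 (mul10 ?E \<beta> \<alpha>) = mul10 A (p1 \<beta>) (p0 \<alpha>)"
    "\<And>\<alpha> \<beta> \<gamma>. \<alpha> \<in> space0 ?E \<Longrightarrow> \<beta> \<in> space0 ?E \<Longrightarrow> \<gamma> \<in> space0 ?E \<Longrightarrow>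
      p1 (l3 ?E \<alpha> \<beta> \<gamma>) = l3 A (p0 \<alpha>) (p0 \<beta>) (p0 \<gamma>)"
    using X.p.hom_bdry X.p.hom_mul00 X.p.hom_mul01 X.p.hom_mul10 X.p.hom_l3 X.p.hom2_zero
    by (simp_all add: hom_defs)
  have i_hom [simp]:
    "\<And>m. m \<in> space1 V \<Longrightarrow> bdry ?E (i1 m) = i0 (bdry V m)"
    "\<And>u v. u \<in> space0 V \<Longrightarrow> v \<in> space0 V \<Longrightarrow> mul00 ?E (i0 u) (i0 v) = 0"
    "\<And>u m. u \<in> space0 V \<Longrightarrow> m \<in> space1 V \<Longrightarrow> mul01 ?E (i0 u) (i1 m) = 0"
    "\<And>u m. u \<in> space0 V \<Longrightarrow> m \<in> space1 V \<Longrightarrow> mul10 ?E (i1 m) (i0 u) = 0"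
    "\<And>u v \<alpha>. u \<in> space0 V \<Longrightarrow> v \<in> space0 V \<Longrightarrow> \<alpha> \<in> space0 ?E \<Longrightarrow> l3 ?E (i0 u) (i0 v) \<alpha> = 0"
    "\<And>u v \<alpha>. u \<in> space0 V \<Longrightarrow> v \<in> space0 V \<Longrightarrow> \<alpha> \<in> space0 ?E \<Longrightarrow> l3 ?E (i0 u) \<alpha> (i0 v) = 0"
    "\<And>u v \<alpha>. u \<in> space0 V \<Longrightarrow> v \<in> space0 V \<Longrightarrow> \<alpha> \<in> space0 ?E \<Longrightarrow> l3 ?E \<alpha> (i0 u) (i0 v) = 0"
    using X.i.hom_bdry X.i.hom_mul00 X.i.hom_mul01 X.i.hom_mul10 X.i.hom2_zero
      linear_onD(4)[OF i0 V.vs0] linear_onD(4)[OF i1 V.vs1] X.l3_vva X.l3_vav X.l3_avv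
    by (simp_all add: hom_defs)
  have action [simp]:
    "\<And>x u. x \<in> space0 A \<Longrightarrow> u \<in> space0 V \<Longrightarrow> mul00 ?E (\<sigma>0 x) (i0 u) = i0 (lact00 V x u)"
    "\<And>x u. x \<in> space0 A \<Longrightarrow> u \<in> space0 V \<Longrightarrow> mul00 ?E (i0 u) (\<sigma>0 x) = i0 (ract00 V u x)"
    "\<And>x m. x \<in> space0 A \<Longrightarrow> m \<in> space1 V \<Longrightarrow> mul01 ?E (\<sigma>0 x) (i1 m) = i1 (lact01 V x m)"
    "\<And>x m. x \<in> space0 A \<Longrightarrow> m \<in> space1 V \<Longrightarrow> mul10 ?E (i1 m) (\<sigma>0 x) = i1 (ract10 V m x)"
    "\<And>a u. a \<in> space1 A \<Longrightarrow> u \<in> space0 V \<Longrightarrow> mul10 ?E (\<sigma>1 a) (i0 u) = i1 (lact10 V a u)"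
    "\<And>a u. a \<in> space1 A \<Longrightarrow> u \<in> space0 V \<Longrightarrow> mul01 ?E (i0 u) (\<sigma>1 a) = i1 (ract01 V u a)"
    "\<And>x y u. x \<in> space0 A \<Longrightarrow> y \<in> space0 A \<Longrightarrow> u \<in> space0 V \<Longrightarrow>
      l3 ?E (\<sigma>0 x) (\<sigma>0 y) (i0 u) = i1 (br_aav V x y u)"
    "\<And>x y u. x \<in> space0 A \<Longrightarrow> y \<in> space0 A \<Longrightarrow> u \<in> space0 V \<Longrightarrow>
      l3 ?E (\<sigma>0 x) (i0 u) (\<sigma>0 y) = i1 (br_ava V x u y)"
    "\<And>x y u. x \<in> space0 A \<Longrightarrow> y \<in> space0 A \<Longrightarrow> u \<in> space0 V \<Longrightarrow>
      l3 ?E (i0 u) (\<sigma>0 x) (\<sigma>0 y) = i1 (br_vaa V u x y)"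
    using assms(3) by (simp_all add: induces_def hom_defs)
  define c where "c = \<lparr>psi = \<lambda>a. k0 (bdry ?E (\<sigma>1 a) - \<sigma>0 (bdry A a)),
    omega = \<lambda>x y. k0 (mul00 ?E (\<sigma>0 x) (\<sigma>0 y) - \<sigma>0 (mul00 A x y)),
    mu = \<lambda>x a. k1 (mul01 ?E (\<sigma>0 x) (\<sigma>1 a) - \<sigma>1 (mul01 A x a)),
    nu = \<lambda>a x. k1 (mul10 ?E (\<sigma>1 a) (\<sigma>0 x) - \<sigma>1 (mul10 A a x)),
    theta = \<lambda>x y z. k1 (l3 ?E (\<sigma>0 x) (\<sigma>0 y) (\<sigma>0 z) - \<sigma>1 (l3 A x y z))\<rparr>"
  have c_in:
    "\<And>a. a \<in> space1 A \<Longrightarrow> psi c a \<in> space0 V"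
    "\<And>x y. x \<in> space0 A \<Longrightarrow> y \<in> space0 A \<Longrightarrow> omega c x y \<in> space0 V"
    "\<And>x a. x \<in> space0 A \<Longrightarrow> a \<in> space1 A \<Longrightarrow> mu c x a \<in> space1 V"
    "\<And>x a. x \<in> space0 A \<Longrightarrow> a \<in> space1 A \<Longrightarrow> nu c a x \<in> space1 V"
    "\<And>x y z. x \<in> space0 A \<Longrightarrow> y \<in> space0 A \<Longrightarrow> z \<in> space0 A \<Longrightarrow> theta c x y z \<in> space1 V"
    by (simp_all add: c_def)
  have ic:
    "\<And>a. a \<in> space1 A \<Longrightarrow> i0 (psi c a) = bdry ?E (\<sigma>1 a) - \<sigma>0 (bdry A a)"
    "\<And>x y. x \<in> space0 A \<Longrightarrow> y \<in> space0 A \<Longrightarrow>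
      i0 (omega c x y) = mul00 ?E (\<sigma>0 x) (\<sigma>0 y) - \<sigma>0 (mul00 A x y)"
    "\<And>x a. x \<in> space0 A \<Longrightarrow> a \<in> space1 A \<Longrightarrow>
      i1 (mu c x a) = mul01 ?E (\<sigma>0 x) (\<sigma>1 a) - \<sigma>1 (mul01 A x a)"
    "\<And>x a. x \<in> space0 A \<Longrightarrow> a \<in> space1 A \<Longrightarrow>
      i1 (nu c a x) = mul10 ?E (\<sigma>1 a) (\<sigma>0 x) - \<sigma>1 (mul10 A a x)"
    "\<And>x y z. x \<in> space0 A \<Longrightarrow> y \<in> space0 A \<Longrightarrow> z \<in> space0 A \<Longrightarrow>
      i1 (theta c x y z) = l3 ?E (\<sigma>0 x) (\<sigma>0 y) (\<sigma>0 z) - \<sigma>1 (l3 A x y z)"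
    by (simp_all add: c_def)
  \<comment> \<open>Multilinearity of \<open>c\<close> can be checked after composition with the injective inclusion, where
    \<open>ic\<close> expresses \<open>c\<close> by the structure maps of \<open>E\<close> and \<open>A\<close>.\<close>
  note cancel0 = linear_on_cancel[OF _ i0 inj0 V.vs0] and cancel1 = linear_on_cancel[OF _ i1 inj1 V.vs1]
  have psi_lin: "linear_on (scale1 A) (scale0 V) (space1 A) (space0 V) (psi c)"
    by (rule cancel0[OF _ A.vs1]; (rule linear_onI)?; simp add: c_in ic algebra_simps)
  have omega_lin: "bilinear_on (scale0 A) (scale0 A) (scale0 V)
      (space0 A) (space0 A) (space0 V) (omega c)"
    unfolding bilinear_on_def
    by (intro conjI ballI; rule cancel0[OF _ A.vs0]; (rule linear_onI)?;
        simp add: c_in ic algebra_simps)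
  have mu_lin: "bilinear_on (scale0 A) (scale1 A) (scale1 V)
      (space0 A) (space1 A) (space1 V) (mu c)"
    unfolding bilinear_on_def
    by (intro conjI ballI; rule cancel1[OF _ A.vs0] cancel1[OF _ A.vs1]; (rule linear_onI)?;
        simp add: c_in ic algebra_simps)
  have nu_lin: "bilinear_on (scale1 A) (scale0 A) (scale1 V)
      (space1 A) (space0 A) (space1 V) (nu c)"
    unfolding bilinear_on_def
    by (intro conjI ballI; rule cancel1[OF _ A.vs0] cancel1[OF _ A.vs1]; (rule linear_onI)?;
        simp add: c_in ic algebra_simps)
  have theta_lin: "trilinear_on (scale0 A) (scale0 A) (scale0 A) (scale1 V)
      (space0 A) (space0 A) (space0 A) (space1 V) (theta c)"
    unfolding trilinear_on_def bilinear_on_def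
    by (intro conjI ballI; rule cancel1[OF _ A.vs0]; (rule linear_onI)?;
        simp add: c_in ic algebra_simps)
  have "extension_cocycle A E \<sigma>0 \<sigma>1 c"
    by (simp add: extension_cocycle_def hom_defs ic)
  moreover have "extension_coordinates A V E (\<lambda>x u. \<sigma>0 x + i0 u) (\<lambda>a m. \<sigma>1 a + i1 m) c"
  proof
    show "space0 ?E = case_prod (\<lambda>x u. \<sigma>0 x + i0 u) ` (space0 A \<times> space0 V)"
    proof (intro equalityI subsetI)
      fix \<alpha> assume "\<alpha> \<in> space0 ?E"
      then show "\<alpha> \<in> case_prod (\<lambda>x u. \<sigma>0 x + i0 u) ` (space0 A \<times> space0 V)"
        by (intro image_eqI[of _ _ "(p0 \<alpha>, k0 (\<alpha> - \<sigma>0 (p0 \<alpha>)))"]) auto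
    qed auto
    show "space1 ?E = case_prod (\<lambda>a m. \<sigma>1 a + i1 m) ` (space1 A \<times> space1 V)"
    proof (intro equalityI subsetI)
      fix \<beta> assume "\<beta> \<in> space1 ?E"
      then show "\<beta> \<in> case_prod (\<lambda>a m. \<sigma>1 a + i1 m) ` (space1 A \<times> space1 V)"
        by (intro image_eqI[of _ _ "(p1 \<beta>, k1 (\<beta> - \<sigma>1 (p1 \<beta>)))"]) auto
    qed auto
    show "\<sigma>0 x + i0 u = \<sigma>0 y + i0 v \<longleftrightarrow> x = y \<and> u = v"
      if "x \<in> space0 A" "u \<in> space0 V" "y \<in> space0 A" "v \<in> space0 V" for x u y v
    proof
      assume eq: "\<sigma>0 x + i0 u = \<sigma>0 y + i0 v"
      have "p0 (\<sigma>0 x + i0 u) = p0 (\<sigma>0 y + i0 v)" using eq by simp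
      then have "x = y" using that by simp
      with eq show "x = y \<and> u = v" using inj0 that by (auto dest: inj_onD)
    qed simp
    show "\<sigma>1 a + i1 m = \<sigma>1 b + i1 n \<longleftrightarrow> a = b \<and> m = n"
      if "a \<in> space1 A" "m \<in> space1 V" "b \<in> space1 A" "n \<in> space1 V" for a m b n
    proof
      assume eq: "\<sigma>1 a + i1 m = \<sigma>1 b + i1 n"
      have "p1 (\<sigma>1 a + i1 m) = p1 (\<sigma>1 b + i1 n)" using eq by simp
      then have "a = b" using that by simp
      with eq show "a = b \<and> m = n" using inj1 that by (auto dest: inj_onD)
    qed simp
  qed (use psi_lin omega_lin mu_lin nu_lin theta_lin X.i.hom2_zero X.p.hom2_zero in
      \<open>simp_all add: c_in ic hom_defs algebra_simps\<close>)
  ultimately show ?thesis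
    by (auto simp: hom_defs)
qed

end

text \<open>
  Only one splitting is assumed to induce the given representation.  Its coordinates show that all
  splittings do, and thus each of them provides coordinates.
\<close>

lemma abelian_extension_coordinates:
  assumes "alg_representation A V" "E \<in> abelian_extensions A V" "splitting A E \<sigma>0 \<sigma>1"
  shows "\<exists>c. extension_cocycle A E \<sigma>0 \<sigma>1 c \<and>
    extension_coordinates A V E (\<lambda>x u. \<sigma>0 x + hom0 (incl E) u) (\<lambda>a m. \<sigma>1 a + hom1 (incl E) m) c"
proof -
  obtain \<tau>0 \<tau>1 where E: "abelian_extension A V E"
    and "splitting A E \<tau>0 \<tau>1" "induces A V E \<tau>0 \<tau>1"
    using assms(2) by (auto simp: abelian_extensions_def)
  then obtain c where
    "extension_coordinates A V E (\<lambda>x u. \<tau>0 x + hom0 (incl E) u) (\<lambda>a m. \<tau>1 a + hom1 (incl E) m) c"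
    using alg_representation.extension_coordinates_if_induces[OF assms(1) E] by blast
  then have "induces A V E \<sigma>0 \<sigma>1"
    using extension_coordinates.induces_if_splitting assms(3) by blast
  then show ?thesis
    using alg_representation.extension_coordinates_if_induces[OF assms(1) E assms(3)] by blast
qed

section \<open>Coboundaries\<close>

text \<open>The difference of the cochains \<open>c\<close> and \<open>d\<close> is the coboundary of \<open>(f, g, h)\<close>.\<close>

locale cobounding = alg_representation A V
  for A :: "('k::field, 'a1::ab_group_add, 'a0::ab_group_add) two_alg"
    and V :: "('k, 'v1::ab_group_add, 'v0::ab_group_add, 'a1, 'a0) rep"
    and c d :: "('a1, 'a0, 'v1, 'v0) cochain" and f g h +
  assumes f_linear: "linear_on (scale0 A) (scale0 V) (space0 A) (space0 V) f"
    and g_linear: "linear_on (scale1 A) (scale1 V) (space1 A) (space1 V) g"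
    and h_bilinear: "bilinear_on (scale0 A) (scale0 A) (scale1 V)
      (space0 A) (space0 A) (space1 V) h"
    and psi_eq: "a \<in> space1 A \<Longrightarrow> psi c a = psi d a + bdry V (g a) - f (bdry A a)"
    and omega_eq: "\<lbrakk>x \<in> space0 A; y \<in> space0 A\<rbrakk> \<Longrightarrow> omega c x y
      = omega d x y + lact00 V x (f y) + ract00 V (f x) y - f (mul00 A x y) + bdry V (h x y)"
    and mu_eq: "\<lbrakk>x \<in> space0 A; a \<in> space1 A\<rbrakk> \<Longrightarrow> mu c x a
      = mu d x a + lact01 V x (g a) + ract01 V (f x) a - g (mul01 A x a) + h x (bdry A a)"
    and nu_eq: "\<lbrakk>x \<in> space0 A; a \<in> space1 A\<rbrakk> \<Longrightarrow> nu c a x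
      = nu d a x + lact10 V a (f x) + ract10 V (g a) x - g (mul10 A a x) + h (bdry A a) x"
    and theta_eq: "\<lbrakk>x \<in> space0 A; y \<in> space0 A; z \<in> space0 A\<rbrakk> \<Longrightarrow> theta c x y z
      = theta d x y z - (lact01 V x (h y z) - ract10 V (h x y) z
          + h x (mul00 A y z) - h (mul00 A x y) z) - g (l3 A x y z)
        + br_aav V x y (f z) + br_ava V x (f y) z + br_vaa V (f x) y z"
begin

lemmas fgh_simps [simp] =
  linear_onD[OF f_linear A.vs0] linear_onD[OF g_linear A.vs1] bilinear_onD[OF h_bilinear A.vs0 A.vs0]

lemmas cochain_eqs = psi_eq omega_eq mu_eq nu_eq theta_eq

end

context alg_representation
begin

lemma coboundary_iff_cobounding:
  "cochain_diff c d \<in> B2 A V \<longleftrightarrow> (\<exists>f g h. cobounding A V c d f g h)"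
proof -
  have "cochain_eq A (cochain_diff c d) (D1 A V f g h)
      \<and> linear_on (scale0 A) (scale0 V) (space0 A) (space0 V) f
      \<and> linear_on (scale1 A) (scale1 V) (space1 A) (space1 V) g
      \<and> bilinear_on (scale0 A) (scale0 A) (scale1 V) (space0 A) (space0 A) (space1 V) h
    \<longleftrightarrow> cobounding A V c d f g h" for f g h
    unfolding cobounding_def cobounding_axioms_def cochain_eq_def cochain_diff_def D1_def
    using alg_representation_axioms by (auto simp: diff_eq_eq algebra_simps)
  then show ?thesis
    unfolding B2_def by blast
qed

lemma cobounding_refl: "cobounding A V c c (\<lambda>_. 0) (\<lambda>_. 0) (\<lambda>_ _. 0)"
  by unfold_locales (auto intro!: linear_onI bilinear_onI)

text \<open>The coboundary is additive; together with reflexivity this yields symmetry and transitivity.\<close>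

lemma cobounding_diff:
  assumes "cobounding A V c e f g h" "cobounding A V d e f' g' h'"
  shows "cobounding A V c d (\<lambda>x. f x - f' x) (\<lambda>a. g a - g' a) (\<lambda>x y. h x y - h' x y)"
proof -
  interpret c: cobounding A V c e f g h by fact
  interpret d: cobounding A V d e f' g' h' by fact
  show ?thesis
    by unfold_locales
      ((rule linear_onI bilinear_onI)?; simp add: c.cochain_eqs d.cochain_eqs algebra_simps)+
qed

lemma equiv_cohomologous: "equiv (Z2 A V) (cohomologous A V)"
proof -
  have refl: "cochain_diff c c \<in> B2 A V" for c
    using cobounding_refl coboundary_iff_cobounding by blast
  have diff: "cochain_diff c d \<in> B2 A V"
    if "cochain_diff c e \<in> B2 A V" "cochain_diff d e \<in> B2 A V" for c d e
    using that cobounding_diff unfolding coboundary_iff_cobounding by blast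
  have sym: "cochain_diff d c \<in> B2 A V" if "cochain_diff c d \<in> B2 A V" for c d
    using diff[OF refl that] .
  show ?thesis
  proof (rule equivI)
    show "trans (cohomologous A V)"
    proof (rule transI)
      fix c d e assume "(c, d) \<in> cohomologous A V" "(d, e) \<in> cohomologous A V"
      then show "(c, e) \<in> cohomologous A V"
        using diff[OF _ sym, of c d e] by (auto simp: cohomologous_def)
    qed
  qed (auto simp: refl_on_def sym_def cohomologous_def refl sym)
qed

end

section \<open>Equivalences of extensions\<close>

locale two_extensions = alg_representation A V +
  X: extension_coordinates A V E J0 J1 c + Y: extension_coordinates A V E' K0 K1 d +
  XA: assoc2_algebra "total E" + YA: assoc2_algebra "total E'"
  for A :: "('k::field, 'a1::ab_group_add, 'a0::ab_group_add) two_alg"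
    and V :: "('k, 'v1::ab_group_add, 'v0::ab_group_add, 'a1, 'a0) rep"
    and E :: "('k, 'v1, 'v0, 'e1::ab_group_add, 'e0::ab_group_add, 'a1, 'a0) ext"
    and J0 J1 c
    and E' :: "('k, 'v1, 'v0, 'f1::ab_group_add, 'f0::ab_group_add, 'a1, 'a0) ext"
    and K0 K1 d
begin

lemma coboundary_if_equivalent:
  assumes "ext_equivalent (abelian_alg V) E E'"
  shows "cochain_diff c d \<in> B2 A V"
proof -
  obtain F where F: "assoc2_hom (total E) (total E') F"
    and incl: "hom_eq (abelian_alg V) (hom_comp F (incl E)) (incl E')"
    and proj: "hom_eq (total E) (hom_comp (proj E') F) (proj E)"
    and F2: "\<And>u \<alpha>. u \<in> space0 V \<Longrightarrow> \<alpha> \<in> space0 (total E) \<Longrightarrow>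
      hom2 F (J0 0 u) \<alpha> = 0 \<and> hom2 F \<alpha> (J0 0 u) = 0"
    using assms by (auto simp: ext_equivalent_def)
  interpret F: assoc2_hom "total E" "total E'" F by fact
  note lin0 [simp] = linear_onD[OF F.hom0_linear X.E.vs0]
    and lin1 [simp] = linear_onD[OF F.hom1_linear X.E.vs1]
    and lin2 [simp] = bilinear_onD[OF F.hom2_bilinear X.E.vs0 X.E.vs0]
  have F0V: "hom0 F (J0 0 u) = K0 0 u" if "u \<in> space0 V" for u
    using incl that by (auto simp: hom_eq_def hom_comp_def)
  have F1V: "hom1 F (J1 0 m) = K1 0 m" if "m \<in> space1 V" for m
    using incl that by (auto simp: hom_eq_def hom_comp_def)
  have p0: "hom0 (proj E') (hom0 F \<alpha>) = hom0 (proj E) \<alpha>" if "\<alpha> \<in> space0 (total E)" for \<alpha>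
    using proj that by (auto simp: hom_eq_def hom_comp_def)
  have p1: "hom1 (proj E') (hom1 F \<beta>) = hom1 (proj E) \<beta>" if "\<beta> \<in> space1 (total E)" for \<beta>
    using proj that by (auto simp: hom_eq_def hom_comp_def)
  have p2: "hom1 (proj E') (hom2 F \<alpha> \<beta>) = 0"
    if "\<alpha> \<in> space0 (total E)" "\<beta> \<in> space0 (total E)" for \<alpha> \<beta>
    using proj that by (auto simp: hom_eq_def hom_comp_def)
  \<comment> \<open>As \<open>F\<close> commutes with the projections, it maps \<open>J0 x 0\<close> into the fibre over \<open>x\<close>, and \<open>F\<^sub>2\<close> takes
    values in \<open>V\<close>; this defines \<open>f\<close>, \<open>g\<close> and \<open>h\<close>.\<close>
  have "\<exists>u. u \<in> space0 V \<and> hom0 F (J0 x 0) = K0 x u" if "x \<in> space0 A" for x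
    using Y.E0_fibre[of "hom0 F (J0 x 0)"] p0[of "J0 x 0"] that by simp
  then obtain f where f [simp]: "\<And>x. x \<in> space0 A \<Longrightarrow> f x \<in> space0 V"
    and F0A: "\<And>x. x \<in> space0 A \<Longrightarrow> hom0 F (J0 x 0) = K0 x (f x)"
    by metis
  have "\<exists>m. m \<in> space1 V \<and> hom1 F (J1 a 0) = K1 a m" if "a \<in> space1 A" for a
    using Y.E1_fibre[of "hom1 F (J1 a 0)"] p1[of "J1 a 0"] that by simp
  then obtain g where g [simp]: "\<And>a. a \<in> space1 A \<Longrightarrow> g a \<in> space1 V"
    and F1A: "\<And>a. a \<in> space1 A \<Longrightarrow> hom1 F (J1 a 0) = K1 a (g a)"
    by metis
  have "\<exists>m. m \<in> space1 V \<and> hom2 F (J0 x 0) (J0 y 0) = K1 0 m"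
    if "x \<in> space0 A" "y \<in> space0 A" for x y
    using Y.E1_fibre[of "hom2 F (J0 x 0) (J0 y 0)"] p2[of "J0 x 0" "J0 y 0"] that by simp
  then obtain h where h [simp]: "\<And>x y. x \<in> space0 A \<Longrightarrow> y \<in> space0 A \<Longrightarrow> h x y \<in> space1 V"
    and F2A: "\<And>x y. x \<in> space0 A \<Longrightarrow> y \<in> space0 A \<Longrightarrow> hom2 F (J0 x 0) (J0 y 0) = K1 0 (h x y)"
    by metis
  have F0: "hom0 F (J0 x u) = K0 x (f x + u)" if "x \<in> space0 A" "u \<in> space0 V" for x u
    using lin0(2)[of "J0 x 0" "J0 0 u"] that by (simp add: F0A F0V)
  have F1: "hom1 F (J1 a m) = K1 a (g a + m)" if "a \<in> space1 A" "m \<in> space1 V" for a m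
    using lin1(2)[of "J1 a 0" "J1 0 m"] that by (simp add: F1A F1V)
  have F2': "hom2 F (J0 x u) (J0 y v) = K1 0 (h x y)"
    if "x \<in> space0 A" "u \<in> space0 V" "y \<in> space0 A" "v \<in> space0 V" for x u y v
    using lin2(2)[of "J0 x 0" "J0 0 u" "J0 y v"] lin2(3)[of "J0 x 0" "J0 y 0" "J0 0 v"] that
    by (simp add: F2A F2)
  note F_simps = F0 F1 F2'
  have "cobounding A V c d f g h"
  proof
    show "linear_on (scale0 A) (scale0 V) (space0 A) (space0 V) f"
    proof (rule linear_onI)
      show "f (x + y) = f x + f y" if "x \<in> space0 A" "y \<in> space0 A" for x y
        using lin0(2)[of "J0 x 0" "J0 y 0"] that by (simp add: F_simps)
      show "f (scale0 A k x) = scale0 V k (f x)" if "x \<in> space0 A" for k x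
        using lin0(3)[of "J0 x 0" k] that by (simp add: F_simps)
    qed simp
    show "linear_on (scale1 A) (scale1 V) (space1 A) (space1 V) g"
    proof (rule linear_onI)
      show "g (a + b) = g a + g b" if "a \<in> space1 A" "b \<in> space1 A" for a b
        using lin1(2)[of "J1 a 0" "J1 b 0"] that by (simp add: F_simps)
      show "g (scale1 A k a) = scale1 V k (g a)" if "a \<in> space1 A" for k a
        using lin1(3)[of "J1 a 0" k] that by (simp add: F_simps)
    qed simp
    show "bilinear_on (scale0 A) (scale0 A) (scale1 V) (space0 A) (space0 A) (space1 V) h"
    proof (rule bilinear_onI)
      show "h (x + x') y = h x y + h x' y"
        if "x \<in> space0 A" "x' \<in> space0 A" "y \<in> space0 A" for x x' y
        using lin2(2)[of "J0 x 0" "J0 x' 0" "J0 y 0"] that by (simp add: F_simps)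
      show "h x (y + y') = h x y + h x y'"
        if "x \<in> space0 A" "y \<in> space0 A" "y' \<in> space0 A" for x y y'
        using lin2(3)[of "J0 x 0" "J0 y 0" "J0 y' 0"] that by (simp add: F_simps)
      show "h (scale0 A k x) y = scale1 V k (h x y)" if "x \<in> space0 A" "y \<in> space0 A" for k x y
        using lin2(4)[of "J0 x 0" "J0 y 0" k] that by (simp add: F_simps)
      show "h x (scale0 A k y) = scale1 V k (h x y)" if "x \<in> space0 A" "y \<in> space0 A" for k x y
        using lin2(5)[of "J0 x 0" "J0 y 0" k] that by (simp add: F_simps)
    qed simp
    show "psi c a = psi d a + bdry V (g a) - f (bdry A a)" if "a \<in> space1 A" for a
      using F.hom_bdry[of "J1 a 0"] that by (simp add: F_simps algebra_simps)
    show "omega c x y = omega d x y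
        + lact00 V x (f y) + ract00 V (f x) y - f (mul00 A x y) + bdry V (h x y)"
      if "x \<in> space0 A" "y \<in> space0 A" for x y
      using F.hom_mul00[of "J0 x 0" "J0 y 0"] that by (simp add: F_simps algebra_simps)
    show "mu c x a = mu d x a
        + lact01 V x (g a) + ract01 V (f x) a - g (mul01 A x a) + h x (bdry A a)"
      if "x \<in> space0 A" "a \<in> space1 A" for x a
      using F.hom_mul01[of "J0 x 0" "J1 a 0"] that by (simp add: F_simps algebra_simps)
    show "nu c a x = nu d a x
        + lact10 V a (f x) + ract10 V (g a) x - g (mul10 A a x) + h (bdry A a) x"
      if "x \<in> space0 A" "a \<in> space1 A" for x a
      using F.hom_mul10[of "J0 x 0" "J1 a 0"] that by (simp add: F_simps algebra_simps)
    show "theta c x y z = theta d x y z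
        - (lact01 V x (h y z) - ract10 V (h x y) z + h x (mul00 A y z) - h (mul00 A x y) z)
        - g (l3 A x y z) + br_aav V x y (f z) + br_ava V x (f y) z + br_vaa V (f x) y z"
      if "x \<in> space0 A" "y \<in> space0 A" "z \<in> space0 A" for x y z
      using F.hom_l3[of "J0 x 0" "J0 y 0" "J0 z 0"] that by (simp add: F_simps algebra_simps)
  qed
  then show ?thesis
    unfolding coboundary_iff_cobounding by blast
qed

lemma equivalent_if_coboundary:
  assumes "cochain_diff c d \<in> B2 A V"
  shows "ext_equivalent (abelian_alg V) E E'"
proof -
  obtain f g h where "cobounding A V c d f g h"
    using assms unfolding coboundary_iff_cobounding by blast
  then interpret fgh: cobounding A V c d f g h .
  define q0 where "q0 = inv_into (space0 A \<times> space0 V) (case_prod J0)"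
  define q1 where "q1 = inv_into (space1 A \<times> space1 V) (case_prod J1)"
  have q0: "q0 (J0 x u) = (x, u)" if "x \<in> space0 A" "u \<in> space0 V" for x u
    using inv_into_f_f[of "case_prod J0" "space0 A \<times> space0 V" "(x, u)"] that
    by (auto simp: q0_def inj_on_def)
  have q1: "q1 (J1 a m) = (a, m)" if "a \<in> space1 A" "m \<in> space1 V" for a m
    using inv_into_f_f[of "case_prod J1" "space1 A \<times> space1 V" "(a, m)"] that
    by (auto simp: q1_def inj_on_def)
  \<comment> \<open>\<open>q0\<close> and \<open>q1\<close> read the coordinates of \<open>E\<close>, in which \<open>F\<close> is the shear defined by \<open>f\<close>, \<open>g\<close>, \<open>h\<close>.\<close>
  define F where "F = \<lparr>hom0 = \<lambda>\<alpha>. case q0 \<alpha> of (x, u) \<Rightarrow> K0 x (u + f x),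
    hom1 = \<lambda>\<beta>. case q1 \<beta> of (a, m) \<Rightarrow> K1 a (m + g a),
    hom2 = \<lambda>\<alpha> \<beta>. K1 0 (h (fst (q0 \<alpha>)) (fst (q0 \<beta>)))\<rparr>"
  have F_simps:
    "\<And>x u. x \<in> space0 A \<Longrightarrow> u \<in> space0 V \<Longrightarrow> hom0 F (J0 x u) = K0 x (u + f x)"
    "\<And>a m. a \<in> space1 A \<Longrightarrow> m \<in> space1 V \<Longrightarrow> hom1 F (J1 a m) = K1 a (m + g a)"
    "\<And>x u y v. x \<in> space0 A \<Longrightarrow> u \<in> space0 V \<Longrightarrow> y \<in> space0 A \<Longrightarrow> v \<in> space0 V \<Longrightarrow>
      hom2 F (J0 x u) (J0 y v) = K1 0 (h x y)"
    by (simp_all add: F_def q0 q1)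
  have "assoc2_hom (total E) (total E') F"
  proof
    show "linear_on (scale0 (total E)) (scale0 (total E')) (space0 (total E)) (space0 (total E'))
        (hom0 F)"
      by (rule linear_onI; elim X.E0_cases; simp add: F_simps ac_simps)
    show "linear_on (scale1 (total E)) (scale1 (total E')) (space1 (total E)) (space1 (total E'))
        (hom1 F)"
      by (rule linear_onI; elim X.E1_cases; simp add: F_simps ac_simps)
    show "bilinear_on (scale0 (total E)) (scale0 (total E)) (scale1 (total E'))
        (space0 (total E)) (space0 (total E)) (space1 (total E')) (hom2 F)"
      by (rule bilinear_onI; elim X.E0_cases; simp add: F_simps ac_simps)
  next
    fix \<beta> assume "\<beta> \<in> space1 (total E)"
    then show "hom0 F (bdry (total E) \<beta>) = bdry (total E') (hom1 F \<beta>)"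
      by (elim X.E1_cases; simp add: F_simps fgh.cochain_eqs algebra_simps)
  next
    fix \<alpha> \<beta> assume "\<alpha> \<in> space0 (total E)" "\<beta> \<in> space0 (total E)"
    then show "hom0 F (mul00 (total E) \<alpha> \<beta>) - mul00 (total E') (hom0 F \<alpha>) (hom0 F \<beta>)
        = bdry (total E') (hom2 F \<alpha> \<beta>)"
      by (elim X.E0_cases; simp add: F_simps fgh.cochain_eqs algebra_simps)
  next
    fix \<alpha> \<beta> assume "\<alpha> \<in> space0 (total E)" "\<beta> \<in> space1 (total E)"
    then show "hom1 F (mul01 (total E) \<alpha> \<beta>) - mul01 (total E') (hom0 F \<alpha>) (hom1 F \<beta>)
        = hom2 F \<alpha> (bdry (total E) \<beta>)"
      and "hom1 F (mul10 (total E) \<beta> \<alpha>) - mul10 (total E') (hom1 F \<beta>) (hom0 F \<alpha>)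
        = hom2 F (bdry (total E) \<beta>) \<alpha>"
      by (elim X.E0_cases X.E1_cases; simp add: F_simps fgh.cochain_eqs algebra_simps)+
  next
    fix \<alpha> \<beta> \<gamma> assume "\<alpha> \<in> space0 (total E)" "\<beta> \<in> space0 (total E)" "\<gamma> \<in> space0 (total E)"
    then show "hom1 F (l3 (total E) \<alpha> \<beta> \<gamma>) - l3 (total E') (hom0 F \<alpha>) (hom0 F \<beta>) (hom0 F \<gamma>)
        = - (hom2 F \<alpha> (mul00 (total E) \<beta> \<gamma>) - hom2 F (mul00 (total E) \<alpha> \<beta>) \<gamma>
             + mul01 (total E') (hom0 F \<alpha>) (hom2 F \<beta> \<gamma>)
             - mul10 (total E') (hom2 F \<alpha> \<beta>) (hom0 F \<gamma>))"
      by (elim X.E0_cases; simp add: F_simps fgh.cochain_eqs algebra_simps)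
  qed
  moreover have "hom_eq (abelian_alg V) (hom_comp F (incl E)) (incl E')"
    by (auto simp: hom_eq_def hom_comp_def F_simps F_simps(2)[of 0 0, simplified])
  moreover have "hom_eq (total E) (hom_comp (proj E') F) (proj E)"
    by (auto simp: hom_eq_def hom_comp_def F_simps elim!: X.E0_cases X.E1_cases)
  moreover have "hom2 F (hom0 (incl E) u) \<alpha> = 0 \<and> hom2 F \<alpha> (hom0 (incl E) u) = 0"
    if "u \<in> space0 V" "\<alpha> \<in> space0 (total E)" for u \<alpha>
    using that by (auto simp: F_simps elim!: X.E0_cases)
  ultimately show ?thesis
    unfolding ext_equivalent_def by auto
qed

end

section \<open>The extension of a cocycle\<close>

lemma embeds_sumE:
  assumes "embeds_sum s S t T r" "vector_space s" "module.subspace s S"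
    "vector_space t" "module.subspace t T"
  obtains J where "vector_space r" "module.subspace r (case_prod J ` (S \<times> T))"
    "inj_on (case_prod J) (S \<times> T)"
    "\<And>x u y v. \<lbrakk>x \<in> S; u \<in> T; y \<in> S; v \<in> T\<rbrakk> \<Longrightarrow> J x u + J y v = J (x + y) (u + v)"
    "\<And>k x u. \<lbrakk>x \<in> S; u \<in> T\<rbrakk> \<Longrightarrow> r k (J x u) = J (s k x) (t k u)"
proof -
  from assms(1) obtain j where r: "vector_space r"
    and j: "linear_on (\<lambda>c (x, u). (s c x, t c u)) r (S \<times> T) UNIV j" and inj: "inj_on j (S \<times> T)"
    by (auto simp: embeds_sum_def)
  interpret r: vector_space r by fact
  note cl = subspace_closed[OF assms(2,3)] subspace_closed[OF assms(4,5)]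
  define J where "J = curry j"
  have add: "J x u + J y v = J (x + y) (u + v)" if "x \<in> S" "u \<in> T" "y \<in> S" "v \<in> T" for x u y v
    using j that unfolding linear_on_def by (auto simp: J_def)
  have scale: "r k (J x u) = J (s k x) (t k u)" if "x \<in> S" "u \<in> T" for k x u
    using j that unfolding linear_on_def by (auto simp: J_def)
  have zero: "J 0 0 = 0" using add[of 0 0 0 0] cl by simp
  have mem: "J x u \<in> case_prod J ` (S \<times> T)" if "x \<in> S" "u \<in> T" for x u
    using that by auto
  have "r.subspace (case_prod J ` (S \<times> T))"
  proof (rule r.subspaceI)
    show "0 \<in> case_prod J ` (S \<times> T)"
      using mem[of 0 0] zero cl by simp
  next
    fix x y assume "x \<in> case_prod J ` (S \<times> T)" "y \<in> case_prod J ` (S \<times> T)"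
    then obtain a u b v where "a \<in> S" "u \<in> T" "b \<in> S" "v \<in> T" "x = J a u" "y = J b v"
      by auto
    then show "x + y \<in> case_prod J ` (S \<times> T)"
      using mem[of "a + b" "u + v"] by (simp add: add cl)
  next
    fix k x assume "x \<in> case_prod J ` (S \<times> T)"
    then obtain a u where "a \<in> S" "u \<in> T" "x = J a u"
      by auto
    then show "r k x \<in> case_prod J ` (S \<times> T)"
      using mem[of "s k a" "t k u"] by (simp add: scale cl)
  qed
  then show ?thesis
    using that[of J] r inj add scale by (simp add: J_def)
qed

text \<open>The structure of \<open>A \<oplus> V\<close> twisted by \<open>c\<close>, transported along the embeddings \<open>J0\<close> and \<open>J1\<close>.\<close>

lemma extension_of_cocycle:
  fixes A :: "('k::field, 'a1::ab_group_add, 'a0::ab_group_add) two_alg"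
    and V :: "('k, 'v1::ab_group_add, 'v0::ab_group_add, 'a1, 'a0) rep"
    and r1 :: "'k \<Rightarrow> 'e1::ab_group_add \<Rightarrow> 'e1"
    and r0 :: "'k \<Rightarrow> 'e0::ab_group_add \<Rightarrow> 'e0"
  assumes "alg_representation A V" "two_cocycle A V c"
    and "embeds_sum (scale1 A) (space1 A) (scale1 V) (space1 V) r1"
    and "embeds_sum (scale0 A) (space0 A) (scale0 V) (space0 V) r0"
  shows "\<exists>(E :: ('k, 'v1, 'v0, 'e1, 'e0, 'a1, 'a0) ext) J0 J1. extension_coordinates A V E J0 J1 c"
proof -
  interpret alg_representation A V by fact
  interpret c: two_cocycle A V c by fact
  obtain J0 where r0: "vector_space r0"
    and sub0: "module.subspace r0 (case_prod J0 ` (space0 A \<times> space0 V))"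
    and inj0: "inj_on (case_prod J0) (space0 A \<times> space0 V)"
    and add0: "\<And>x u y v. \<lbrakk>x \<in> space0 A; u \<in> space0 V; y \<in> space0 A; v \<in> space0 V\<rbrakk> \<Longrightarrow>
      J0 x u + J0 y v = J0 (x + y) (u + v)"
    and scale0: "\<And>k x u. \<lbrakk>x \<in> space0 A; u \<in> space0 V\<rbrakk> \<Longrightarrow>
      r0 k (J0 x u) = J0 (scale0 A k x) (scale0 V k u)"
    using embeds_sumE[OF assms(4) A.vs0 V.vs0] by blast
  obtain J1 where r1: "vector_space r1"
    and sub1: "module.subspace r1 (case_prod J1 ` (space1 A \<times> space1 V))"
    and inj1: "inj_on (case_prod J1) (space1 A \<times> space1 V)"
    and add1: "\<And>x u y v. \<lbrakk>x \<in> space1 A; u \<in> space1 V; y \<in> space1 A; v \<in> space1 V\<rbrakk> \<Longrightarrow>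
      J1 x u + J1 y v = J1 (x + y) (u + v)"
    and scale1: "\<And>k x u. \<lbrakk>x \<in> space1 A; u \<in> space1 V\<rbrakk> \<Longrightarrow>
      r1 k (J1 x u) = J1 (scale1 A k x) (scale1 V k u)"
    using embeds_sumE[OF assms(3) A.vs1 V.vs1] by blast
  define q0 where "q0 = inv_into (space0 A \<times> space0 V) (case_prod J0)"
  define q1 where "q1 = inv_into (space1 A \<times> space1 V) (case_prod J1)"
  have q0: "q0 (J0 x u) = (x, u)" if "x \<in> space0 A" "u \<in> space0 V" for x u
    using inv_into_f_f[OF inj0, of "(x, u)"] that by (simp add: q0_def)
  have q1: "q1 (J1 a m) = (a, m)" if "a \<in> space1 A" "m \<in> space1 V" for a m
    using inv_into_f_f[OF inj1, of "(a, m)"] that by (simp add: q1_def)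
  define T where "T = \<lparr>scale1 = r1, scale0 = r0,
    space1 = case_prod J1 ` (space1 A \<times> space1 V), space0 = case_prod J0 ` (space0 A \<times> space0 V),
    bdry = \<lambda>\<beta>. case q1 \<beta> of (a, m) \<Rightarrow> J0 (bdry A a) (bdry V m + psi c a),
    mul00 = \<lambda>\<alpha> \<beta>. case q0 \<alpha> of (x, u) \<Rightarrow> case q0 \<beta> of (y, v) \<Rightarrow>
      J0 (mul00 A x y) (lact00 V x v + ract00 V u y + omega c x y),
    mul01 = \<lambda>\<alpha> \<beta>. case q0 \<alpha> of (x, u) \<Rightarrow> case q1 \<beta> of (a, m) \<Rightarrow>
      J1 (mul01 A x a) (lact01 V x m + ract01 V u a + mu c x a),
    mul10 = \<lambda>\<beta> \<alpha>. case q1 \<beta> of (a, m) \<Rightarrow> case q0 \<alpha> of (x, u) \<Rightarrow>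
      J1 (mul10 A a x) (lact10 V a u + ract10 V m x + nu c a x),
    l3 = \<lambda>\<alpha> \<beta> \<gamma>. case q0 \<alpha> of (x, u) \<Rightarrow> case q0 \<beta> of (y, v) \<Rightarrow> case q0 \<gamma> of (z, w) \<Rightarrow>
      J1 (l3 A x y z) (br_aav V x y w + br_ava V x v z + br_vaa V u y z + theta c x y z)\<rparr>"
  define E :: "('k, 'v1, 'v0, 'e1, 'e0, 'a1, 'a0) ext" where "E = \<lparr>total = T,
    incl = \<lparr>hom0 = J0 0, hom1 = J1 0, hom2 = \<lambda>_ _. 0\<rparr>,
    proj = \<lparr>hom0 = \<lambda>\<alpha>. fst (q0 \<alpha>), hom1 = \<lambda>\<beta>. fst (q1 \<beta>), hom2 = \<lambda>_ _. 0\<rparr>\<rparr>"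
  have mem0: "J0 x u \<in> space0 T" if "x \<in> space0 A" "u \<in> space0 V" for x u
    using that by (auto simp: T_def)
  have T1_cases: "\<exists>a\<in>space1 A. \<exists>m\<in>space1 V. \<beta> = J1 a m" if "\<beta> \<in> space1 T" for \<beta>
    using that by (auto simp: T_def)
  have bdry_T: "bdry T (J1 a m) = J0 (bdry A a) (bdry V m + psi c a)"
    if "a \<in> space1 A" "m \<in> space1 V" for a m
    using that by (simp add: T_def q1)
  have "linear_on r1 r0 (space1 T) (space0 T) (bdry T)"
    using linear_onD[OF c.psi_linear A.vs1]
    by (intro linear_onI)
      (auto simp: bdry_T mem0 add0 add1 scale0 scale1 ac_simps dest!: T1_cases)
  then have "two_term_complex T"
    using r0 r1 sub0 sub1 by (intro two_term_complex.intro) (simp_all add: T_def)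
  moreover have "x = y \<and> u = v" if "J0 x u = J0 y v"
    "x \<in> space0 A" "u \<in> space0 V" "y \<in> space0 A" "v \<in> space0 V" for x u y v
    using inj_onD[OF inj0, of "(x, u)" "(y, v)"] that by simp
  moreover have "a = b \<and> m = n" if "J1 a m = J1 b n"
    "a \<in> space1 A" "m \<in> space1 V" "b \<in> space1 A" "n \<in> space1 V" for a b m n
    using inj_onD[OF inj1, of "(a, m)" "(b, n)"] that by simp
  ultimately have "extension_coordinates A V E J0 J1 c"
    using c.psi_linear c.omega_bilinear c.mu_bilinear c.nu_bilinear c.theta_trilinear
    by (intro extension_coordinates.intro twisted_sum.intro twisted_sum_axioms.intro
        extension_coordinates_axioms.intro alg_representation_axioms)
      (auto simp: E_def T_def q0 q1 add0 add1 scale0 scale1)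
  then show ?thesis by blast
qed

section \<open>The bijection of the quotients\<close>

text \<open>
  A relation that is total on both sides and matches \<open>R\<close> with the equivalence relation \<open>S\<close> induces
  a bijection of the quotients.  That \<open>R\<close> is an equivalence relation need not be assumed: it
  follows, because \<open>R\<close> is the preimage of \<open>S\<close>.
\<close>

lemma quotient_bijection:
  assumes S: "equiv Z S" and R: "R \<subseteq> X \<times> X"
    and total: "\<And>x. x \<in> X \<Longrightarrow> \<exists>z\<in>Z. C x z"
    and onto: "\<And>z. z \<in> Z \<Longrightarrow> \<exists>x\<in>X. C x z"
    and iff: "\<And>x y z w. \<lbrakk>x \<in> X; y \<in> X; z \<in> Z; w \<in> Z; C x z; C y w\<rbrakk> \<Longrightarrow>
      (x, y) \<in> R \<longleftrightarrow> (z, w) \<in> S"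
  shows "\<exists>\<Phi>. bij_betw \<Phi> (X // R) (Z // S) \<and>
    (\<forall>x\<in>X. \<forall>z\<in>Z. C x z \<longrightarrow> \<Phi> (R `` {x}) = S `` {z})"
proof -
  have refl: "(x, x) \<in> R" if "x \<in> X" for x
    using that total[OF that] iff[of x x] S by (auto dest: equiv_class_self)
  define \<Phi> where "\<Phi> Q = (\<Union>x\<in>Q. \<Union>z\<in>{z\<in>Z. C x z}. S `` {z})" for Q
  have \<Phi>: "\<Phi> (R `` {x}) = S `` {z}" if "x \<in> X" "z \<in> Z" "C x z" for x z
  proof -
    have "S `` {w} = S `` {z}" if "y \<in> R `` {x}" "w \<in> Z" "C y w" for y w
    proof -
      have "(x, y) \<in> R" "y \<in> X" using that R by auto
      then have "(z, w) \<in> S" using iff \<open>x \<in> X\<close> \<open>z \<in> Z\<close> \<open>C x z\<close> that by blast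
      then show ?thesis using equiv_class_eq[OF S] by blast
    qed
    moreover have "x \<in> R `` {x}" using refl that by blast
    ultimately show ?thesis using that unfolding \<Phi>_def by blast
  qed
  have "inj_on \<Phi> (X // R)"
  proof (rule inj_onI)
    fix P Q assume "P \<in> X // R" "Q \<in> X // R" and eq: "\<Phi> P = \<Phi> Q"
    then obtain x y where x: "x \<in> X" "P = R `` {x}" and y: "y \<in> X" "Q = R `` {y}"
      by (auto simp: quotient_def)
    obtain z w where z: "z \<in> Z" "C x z" and w: "w \<in> Z" "C y w" using total x y by blast
    have zw: "(z, w) \<in> S"
      using eq \<Phi> x y z w eq_equiv_class[OF _ S] by metis
    have "(x, t) \<in> R \<longleftrightarrow> (y, t) \<in> R" for t
    proof (cases "t \<in> X")
      case True
      then obtain v where v: "v \<in> Z" "C t v" using total by blast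
      have "(z, v) \<in> S \<longleftrightarrow> (w, v) \<in> S"
        using equiv_class_eq[OF S zw] by blast
      then show ?thesis using iff x y z w v True by blast
    qed (use R in auto)
    then show "P = Q" using x y by blast
  qed
  moreover have "\<Phi> ` (X // R) = Z // S"
  proof (intro equalityI subsetI)
    fix K assume "K \<in> \<Phi> ` (X // R)"
    then obtain x where "x \<in> X" "K = \<Phi> (R `` {x})" by (auto simp: quotient_def)
    then show "K \<in> Z // S" using \<Phi> total by (metis quotientI)
  next
    fix K assume "K \<in> Z // S"
    then obtain z where z: "z \<in> Z" "K = S `` {z}" by (auto simp: quotient_def)
    obtain x where "x \<in> X" "C x z" using onto z by blast
    then show "K \<in> \<Phi> ` (X // R)" using \<Phi> z by (metis quotientI image_eqI)
  qed
  ultimately show ?thesis using \<Phi> by (auto simp: bij_betw_def)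
qed

theorem theorem4p4:
  fixes A :: "('k::field, 'a1::ab_group_add, 'a0::ab_group_add) two_alg"
    and V :: "('k, 'v1::ab_group_add, 'v0::ab_group_add, 'a1, 'a0) rep"
    and r1 :: "'k \<Rightarrow> 'e1::ab_group_add \<Rightarrow> 'e1"
    and r0 :: "'k \<Rightarrow> 'e0::ab_group_add \<Rightarrow> 'e0"
  assumes "assoc2_algebra A"
    and "alg_representation A V"
    and "embeds_sum (scale1 A) (space1 A) (scale1 V) (space1 V) r1"
    and "embeds_sum (scale0 A) (space0 A) (scale0 V) (space0 V) r0"
  shows "\<exists>\<Phi>.
    bij_betw \<Phi>
      ((abelian_extensions A V :: ('k, 'v1, 'v0, 'e1, 'e0, 'a1, 'a0) ext set) // ext_rel A V)
      (H2 A V) \<and>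
    (\<forall>E \<in> abelian_extensions A V. \<forall>\<sigma>0 \<sigma>1. splitting A E \<sigma>0 \<sigma>1 \<longrightarrow>
      (\<exists>c \<in> Z2 A V. extension_cocycle A E \<sigma>0 \<sigma>1 c \<and>
        \<Phi> (ext_rel A V `` {E}) = cohomologous A V `` {c}))"
proof -
  interpret alg_representation A V by fact
  let ?X = "abelian_extensions A V :: ('k, 'v1, 'v0, 'e1, 'e0, 'a1, 'a0) ext set"
  define C where "C E c \<longleftrightarrow> (\<exists>J0 J1. extension_coordinates A V E J0 J1 c)"
    for E :: "('k, 'v1, 'v0, 'e1, 'e0, 'a1, 'a0) ext" and c
  have algebra: "assoc2_algebra (total E)" if "E \<in> ?X" for E
    using that
    by (auto simp: abelian_extensions_def abelian_extension_def extension_def strict_hom_def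
        assoc2_hom_def)
  have cocycle: "\<exists>c\<in>Z2 A V. extension_cocycle A E \<sigma>0 \<sigma>1 c \<and> C E c"
    if E: "E \<in> ?X" and s: "splitting A E \<sigma>0 \<sigma>1" for E \<sigma>0 \<sigma>1
  proof -
    obtain c where c: "extension_cocycle A E \<sigma>0 \<sigma>1 c"
      and coords: "extension_coordinates A V E
        (\<lambda>x u. \<sigma>0 x + hom0 (incl E) u) (\<lambda>a m. \<sigma>1 a + hom1 (incl E) m) c"
      using abelian_extension_coordinates[OF assms(2) E s] by blast
    have "c \<in> Z2 A V"
      using twisted_sum.cocycle_if_algebra[OF extension_coordinates.axioms(1)[OF coords]] algebra[OF E]
      by (simp add: Z2_def)
    with c coords show ?thesis by (auto simp: C_def)
  qed
  have "\<exists>\<Phi>. bij_betw \<Phi> (?X // ext_rel A V) (Z2 A V // cohomologous A V) \<and>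
    (\<forall>E\<in>?X. \<forall>c\<in>Z2 A V. C E c \<longrightarrow> \<Phi> (ext_rel A V `` {E}) = cohomologous A V `` {c})"
  proof (rule quotient_bijection[OF equiv_cohomologous])
    show "ext_rel A V \<subseteq> ?X \<times> ?X"
      by (auto simp: ext_rel_def)
    show "\<exists>c\<in>Z2 A V. C E c" if E: "E \<in> ?X" for E
    proof -
      obtain \<sigma>0 \<sigma>1 where "splitting A E \<sigma>0 \<sigma>1"
        using E unfolding abelian_extensions_def by blast
      with cocycle[OF E] show ?thesis by blast
    qed
    show "\<exists>E\<in>?X. C E c" if "c \<in> Z2 A V" for c
    proof -
      have c: "two_cocycle A V c" using that by (simp add: Z2_def)
      obtain E :: "('k, 'v1, 'v0, 'e1, 'e0, 'a1, 'a0) ext" and J0 J1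
        where coords: "extension_coordinates A V E J0 J1 c"
        using extension_of_cocycle[OF assms(2) c assms(3,4)] by blast
      interpret E: extension_coordinates A V E J0 J1 c by fact
      have "E \<in> ?X"
        by (rule E.abelian_extension_if_algebra[OF E.algebra_if_cocycle[OF c]])
      with coords show ?thesis by (auto simp: C_def)
    qed
    show "(E, E') \<in> ext_rel A V \<longleftrightarrow> (c, d) \<in> cohomologous A V"
      if E: "E \<in> ?X" "E' \<in> ?X" "c \<in> Z2 A V" "d \<in> Z2 A V" "C E c" "C E' d" for E E' c d
    proof -
      obtain J0 J1 K0 K1 where coords: "extension_coordinates A V E J0 J1 c"
        "extension_coordinates A V E' K0 K1 d"
        using E by (auto simp: C_def)
      interpret two_extensions A V E J0 J1 c E' K0 K1 d
        by (intro two_extensions.intro coords algebra E assms)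
      show ?thesis
        using E coboundary_if_equivalent equivalent_if_coboundary
        by (auto simp: ext_rel_def cohomologous_def)
    qed
  qed
  then obtain \<Phi> where "bij_betw \<Phi> (?X // ext_rel A V) (H2 A V)"
    and "\<And>E c. E \<in> ?X \<Longrightarrow> c \<in> Z2 A V \<Longrightarrow> C E c \<Longrightarrow>
      \<Phi> (ext_rel A V `` {E}) = cohomologous A V `` {c}"
    by (auto simp: H2_def)
  then show ?thesis
    using cocycle by (intro exI[of _ \<Phi>] conjI ballI allI impI) blast+
qed

end
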